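(* Let $p,q\in\mathbb{R}$ with $q<0\le p$, let $Q\in\mathcal{S}_o^n$, and let $K_i\in\mathcal{K}_o^n$ for each $i=0,1,2,\dots$. If the sequence of measures $\{\widetilde{C}_{p,q}(K_i,Q,\cdot)\}_{i\ge1}$ converges weakly to $\widetilde{C}_{p,q}(K_0,Q,\cdot)$, then $\{K_i\}_{i\ge1}$ converges to $K_0$ in the Hausdorff metric.
   Context: $S^{n-1}$ is the unit sphere of $\mathbb{R}^n$ and $du$ is spherical Lebesgue measure. $\mathcal{K}_o^n$ is the set of convex bodies (compact convex sets with non-empty interior) in $\mathbb{R}^n$ containing the origin in their interiors. $\mathcal{S}_o^n$ is the set of star bodies (compact sets, star-shaped with respect to the origin, with continuous radial function) in $\mathbb{R}^n$ containing the origin in their interiors. The radial function is $\rho_Q(u)=\max\{\lambda\ge 0:\lambda u\in Q\}$, $u\in S^{n-1}$, and the support function is $h_K(v)=\max\{v\cdot x:x\in K\}$. For $K\in\mathcal{K}_o^n$ and a Borel set $\eta\subseteq S^{n-1}$, $\boldsymbol{\alpha}^*_K(\eta)$ is the set of $u\in S^{n-1}$ such that some $v\in\eta$ is an outer unit normal of $K$ at $\rho_K(u)u$, i.e. $\rho_K(u)u\cdot v=h_K(v)$. For $q\in\mathbb{R}$, $\widetilde{C}_q(K,Q,\eta)=\frac1n\int_{\boldsymbol{\alpha}^*_K(\eta)}\rho_K^q(u)\rho_Q^{n-q}(u)\,du$, and for $p,q\in\mathbb{R}$ the $L_p$ dual curvature measure is the Borel measure on $S^{n-1}$ given by $d\widetilde{C}_{p,q}(K,Q,\cdot)=h_K^{-p}\,d\widetilde{C}_q(K,Q,\cdot)$.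 Weak convergence $\mu_i\to\mu$ of finite Borel measures on $S^{n-1}$ means $\int f\,d\mu_i\to\int f\,d\mu$ for every continuous $f:S^{n-1}\to\mathbb{R}$. The Hausdorff distance of $K,L\in\mathcal{K}_o^n$ is $\max_{u\in S^{n-1}}|h_K(u)-h_L(u)|$. *)

theory Defs
  imports "HOL-Analysis.Analysis"
begin

text \<open>
  The dimension \<open>n\<close> is \<open>DIM('a)\<close>.  The maxima defining the radial function, the support function
  and the Hausdorff distance are written as suprema (\<open>Max\<close> is only meaningful on finite sets);
  for the bodies considered here they are attained.
\<close>

definition convex_bodies_o :: "'a::euclidean_space set set" where
  "convex_bodies_o = {K. compact K \<and> convex K \<and> 0 \<in> interior K}"

definition radial :: "'a::euclidean_space set \<Rightarrow> 'a \<Rightarrow> real" where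
  "radial Q u = Sup {r. 0 \<le> r \<and> r *\<^sub>R u \<in> Q}"

definition star_bodies_o :: "'a::euclidean_space set set" where
  "star_bodies_o = {Q. compact Q \<and> (\<forall>x\<in>Q. closed_segment 0 x \<subseteq> Q) \<and>
     continuous_on (sphere 0 1) (radial Q) \<and> 0 \<in> interior Q}"

definition support_fun :: "'a::euclidean_space set \<Rightarrow> 'a \<Rightarrow> real" where
  "support_fun K v = (SUP x\<in>K. v \<bullet> x)"

definition hausdorff_distance :: "'a::euclidean_space set \<Rightarrow> 'a set \<Rightarrow> real" where
  "hausdorff_distance K L = (SUP u\<in>sphere 0 1. \<bar>support_fun K u - support_fun L u\<bar>)"

definition sphere_borel :: "'a::euclidean_space measure" where
  "sphere_borel = restrict_space borel (sphere 0 1)"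

text \<open>
  Spherical Lebesgue measure gives a set \<open>A\<close> of directions \<open>n\<close> times the volume of the cone
  \<open>{r *\<^sub>R u | r u. u \<in> A \<and> 0 < r < 1}\<close>; for \<open>n = 1\<close> this is counting measure on the two points
  of the sphere.  It is completed because \<open>reverse_radial_gauss K \<eta>\<close> below need not be a Borel set
  when \<open>\<eta>\<close> is one; it is then only Lebesgue measurable.
\<close>

definition spherical_lebesgue :: "'a::euclidean_space measure" where
  "spherical_lebesgue = completion (scale_measure (of_nat DIM('a))
     (distr (restrict_space lborel (ball 0 1 - {0})) sphere_borel (\<lambda>x. x /\<^sub>R norm x)))"

definition reverse_radial_gauss :: "'a::euclidean_space set \<Rightarrow> 'a set \<Rightarrow> 'a set" where
  "reverse_radial_gauss K \<eta> =
     {u \<in> sphere 0 1. \<exists>v\<in>\<eta>. (radial K u *\<^sub>R u) \<bullet> v = support_fun K v}"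

definition dual_curvature :: "real \<Rightarrow> 'a::euclidean_space set \<Rightarrow> 'a set \<Rightarrow> 'a measure" where
  "dual_curvature q K Q = measure_of (sphere 0 1) (sets sphere_borel)
     (\<lambda>\<eta>. ennreal (1 / real DIM('a)) *
        (\<integral>\<^sup>+ u \<in> reverse_radial_gauss K \<eta>.
           ennreal (radial K u powr q * radial Q u powr (real DIM('a) - q)) \<partial>spherical_lebesgue))"

definition Lp_dual_curvature ::
    "real \<Rightarrow> real \<Rightarrow> 'a::euclidean_space set \<Rightarrow> 'a set \<Rightarrow> 'a measure" where
  "Lp_dual_curvature p q K Q =
     density (dual_curvature q K Q) (\<lambda>v. ennreal (support_fun K v powr (- p)))"

text \<open>Intended for finite Borel measures on the sphere, for which all the integrals exist.\<close>

definition weakly_converges_sphere ::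
    "(nat \<Rightarrow> 'a::euclidean_space measure) \<Rightarrow> 'a measure \<Rightarrow> bool" where
  "weakly_converges_sphere \<mu> \<nu> \<longleftrightarrow>
     (\<forall>f :: 'a \<Rightarrow> real. continuous_on (sphere 0 1) f \<longrightarrow>
        (\<lambda>i. \<integral>v. f v \<partial>\<mu> i) \<longlonglongrightarrow> (\<integral>v. f v \<partial>\<nu>))"

end

theory Submission
  imports Defs "HOL-Complex_Analysis.Great_Picard"
begin

text \<open>
  Write \<open>\<mu> K\<close> for the \<open>L\<^sub>p\<close> dual curvature measure of \<open>K\<close> and let \<open>\<alpha> K u\<close> be the outer unit normal
  of \<open>K\<close> at the boundary point \<open>radial K u *\<^sub>R u\<close>.

  The theorem is a compactness argument around an Aleksandrov-type comparison of two bodies.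
  At the normal \<open>v = \<alpha> K u\<close> the equation \<open>radial K u * (u \<bullet> v) = support_fun K v\<close> holds, whereas
  only \<open>radial L u * (u \<bullet> v) \<le> support_fun L v\<close> is known for another body \<open>L\<close>. Dividing gives
  \<open>support_fun K / support_fun L \<le> radial K u / radial L u\<close> at \<open>\<alpha> K u\<close> and the opposite
  inequality at \<open>\<alpha> L u\<close>. Integrating these two pointwise inequalities, \<open>comparison_inequality\<close>
  bounds
  \<open>(radial K / radial L - 1) * (radial L powr q - radial K powr q)\<close>, integrated over the sphere
  with a positive weight, by the difference of the integrals of
  \<open>(support_fun K / support_fun L - 1) * support_fun L powr p\<close> against \<open>\<mu> L\<close> and \<open>\<mu> K\<close>.
  The integrand on the left is nonnegative because \<open>q < 0\<close>, and it vanishes only where the two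
  radial functions agree; the sign of \<open>p\<close> enters when \<open>support_fun K powr (- p)\<close> is replaced by
  \<open>support_fun L powr (- p)\<close>. In particular, equal measures force equal bodies.

  For a weakly convergent sequence \<open>\<mu> (K i)\<close> the right-hand side with \<open>L = K 0\<close> tends to \<open>0\<close> along
  every subsequence on which the support functions converge uniformly. Such subsequences exist by
  the Arzela-Ascoli theorem once the bodies lie between two fixed balls about the origin:

  \<^item> If some radial function has a large value at \<open>w\<close>, then every boundary point with normal
    \<open>v\<close> such that \<open>v \<bullet> w\<close> is not small is far away, so \<open>radial powr q\<close> and
    \<open>support_fun powr (- p)\<close> are small there, and \<open>\<mu> (K i)\<close> has little mass on the open hemisphere
    about \<open>w\<close> (\<open>hemisphere_moment_le\<close>). In the limit, however, every open hemisphere has positive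
    mass (\<open>hemisphere_moment_pos\<close>).

  \<^item> If the bodies are bounded but some support function has a small value at \<open>w\<close>, then the
    radial function is small in all directions \<open>u\<close> such that \<open>u \<bullet> w\<close> is not small, so
    \<open>radial powr q\<close> is large there and the total mass is too large (\<open>total_mass_ge\<close>).

  All integrals are computed by a change of variables from normals \<open>v\<close> to directions \<open>u\<close>, which
  requires that almost every direction \<open>u\<close> has only one outer normal. This is the almost everywhere
  differentiability of the gauge of \<open>K\<close>. It is proved by an elementary argument: the directions with
  two normals are covered by countably many closed sets, each of which meets every line of a certain
  direction in at most one point.
\<close>

section \<open>Radial and support functions of a convex body\<close>

text \<open>
  These relations between the radial function \<open>\<rho>\<close> and the support function \<open>h\<close> of a body carry
  the geometry of all later arguments. They are symmetric under polarity, which exchanges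
  \<open>(\<rho>, h)\<close> with \<open>(1 / h, 1 / \<rho>)\<close>. The bounds \<open>r\<close> and \<open>R\<close> are recorded because they control the
  Lipschitz constants of \<open>h\<close> and \<open>\<rho>\<close>, uniformly over a family of bodies.
\<close>

definition radial_support_pair ::
    "real \<Rightarrow> real \<Rightarrow> ('a::euclidean_space \<Rightarrow> real) \<Rightarrow> ('a \<Rightarrow> real) \<Rightarrow> bool" where
  "radial_support_pair r R \<rho> h \<longleftrightarrow>
     0 < r \<and>
     (\<forall>u\<in>sphere 0 1. r \<le> \<rho> u \<and> \<rho> u \<le> R) \<and>
     (\<forall>v\<in>sphere 0 1. r \<le> h v \<and> h v \<le> R) \<and>
     (\<forall>u\<in>sphere 0 1. \<forall>v\<in>sphere 0 1. \<rho> u * (u \<bullet> v) \<le> h v) \<and>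
     (\<forall>u\<in>sphere 0 1. \<exists>v\<in>sphere 0 1. \<rho> u * (u \<bullet> v) = h v) \<and>
     (\<forall>v\<in>sphere 0 1. \<exists>u\<in>sphere 0 1. \<rho> u * (u \<bullet> v) = h v)"

lemma radial_support_pairD:
  assumes "radial_support_pair r R \<rho> h"
  shows "0 < r"
    and "\<And>u. norm u = 1 \<Longrightarrow> r \<le> \<rho> u" and "\<And>u. norm u = 1 \<Longrightarrow> \<rho> u \<le> R"
    and "\<And>v. norm v = 1 \<Longrightarrow> r \<le> h v" and "\<And>v. norm v = 1 \<Longrightarrow> h v \<le> R"
    and "\<And>u v. norm u = 1 \<Longrightarrow> norm v = 1 \<Longrightarrow> \<rho> u * (u \<bullet> v) \<le> h v"
    and "\<And>u. norm u = 1 \<Longrightarrow> \<exists>v. norm v = 1 \<and> \<rho> u * (u \<bullet> v) = h v"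
    and "\<And>v. norm v = 1 \<Longrightarrow> \<exists>u. norm u = 1 \<and> \<rho> u * (u \<bullet> v) = h v"
  using assms unfolding radial_support_pair_def by (auto simp: Bex_def)

lemma radial_support_pair_pos:
  assumes "radial_support_pair r R \<rho> h" and "norm u = 1"
  shows "0 < \<rho> u" and "0 < h u"
  using radial_support_pairD(1)[OF assms(1)] radial_support_pairD(2,4)[OF assms]
  by linarith+

lemma inner_le_one: "norm u = 1 \<Longrightarrow> norm v = 1 \<Longrightarrow> u \<bullet> v \<le> (1::real)"
  using norm_cauchy_schwarz[of u v] by simp

text \<open>
  One bound on each function suffices: since \<open>u \<bullet> v \<le> 1\<close>, equality at a contact direction
  gives \<open>h v \<le> \<rho> u\<close>, so a lower bound passes from \<open>h\<close> to \<open>\<rho>\<close> and an upper bound from \<open>\<rho>\<close> to \<open>h\<close>.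
\<close>

lemma radial_support_pair_bounds:
  assumes P: "radial_support_pair r R \<rho> h"
    and "0 < r'" and h: "\<And>v. norm v = 1 \<Longrightarrow> r' \<le> h v" and \<rho>: "\<And>u. norm u = 1 \<Longrightarrow> \<rho> u \<le> R'"
  shows "radial_support_pair r' R' \<rho> h"
proof -
  note D = radial_support_pairD[OF P] and pos = radial_support_pair_pos[OF P]
  have "r' \<le> \<rho> u" if u: "norm u = 1" for u
  proof -
    obtain v where v: "norm v = 1" "\<rho> u * (u \<bullet> v) = h v" using D(7) u by blast
    have "\<rho> u * (u \<bullet> v) \<le> \<rho> u * 1"
      using pos(1)[OF u] inner_le_one[OF u v(1)] by (intro mult_left_mono) auto
    then show ?thesis using h[OF v(1)] v(2) by simp
  qed
  moreover have "h v \<le> R'" if v: "norm v = 1" for v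
  proof -
    obtain u where u: "norm u = 1" "\<rho> u * (u \<bullet> v) = h v" using D(8) v by blast
    have "\<rho> u * (u \<bullet> v) \<le> \<rho> u * 1"
      using pos(1)[OF u(1)] inner_le_one[OF u(1) v] by (intro mult_left_mono) auto
    then show ?thesis using \<rho>[OF u(1)] u(2) by simp
  qed
  ultimately show ?thesis
    using assms D(6-8) unfolding radial_support_pair_def by (auto simp: Bex_def)
qed

lemma support_fun_upper:
  assumes "compact K" "x \<in> K" shows "v \<bullet> x \<le> support_fun K v"
proof -
  have "compact ((\<bullet>) v ` K)"
    using assms(1) by (intro compact_continuous_image continuous_intros)
  then have "bdd_above ((\<bullet>) v ` K)" by (simp add: bounded_imp_bdd_above compact_imp_bounded)
  then show ?thesis unfolding support_fun_def using assms(2) by (intro cSUP_upper)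
qed

lemma support_fun_eqI:
  assumes "y \<in> K" "\<And>x. x \<in> K \<Longrightarrow> v \<bullet> x \<le> v \<bullet> y" shows "support_fun K v = v \<bullet> y"
  unfolding support_fun_def by (intro cSup_eq_maximum) (use assms in auto)

lemma radial_in:
  assumes "compact K" "0 \<in> K" "norm u = 1"
  shows "radial K u *\<^sub>R u \<in> K" and "0 \<le> radial K u"
    and "\<And>t. 0 \<le> t \<Longrightarrow> t *\<^sub>R u \<in> K \<Longrightarrow> t \<le> radial K u"
proof -
  let ?T = "{r. 0 \<le> r \<and> r *\<^sub>R u \<in> K}"
  obtain B where B: "\<And>x. x \<in> K \<Longrightarrow> norm x \<le> B"
    using assms(1) compact_imp_bounded bounded_iff by metis
  have bdd: "bdd_above ?T" using B assms(3) by (intro bdd_aboveI[of _ B]) force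
  have "closed ((\<lambda>r::real. r *\<^sub>R u) -` K)"
    using assms(1) by (intro continuous_closed_vimage compact_imp_closed) (auto intro!: continuous_intros)
  then have "closed ({0..} \<inter> (\<lambda>r::real. r *\<^sub>R u) -` K)" by (intro closed_Int closed_atLeast)
  also have "{0..} \<inter> (\<lambda>r::real. r *\<^sub>R u) -` K = ?T" by auto
  finally have "closed ?T" .
  moreover have "0 \<in> ?T" using assms(2) by simp
  ultimately have "Sup ?T \<in> ?T" using bdd closed_contains_Sup[of ?T] by blast
  then show "radial K u *\<^sub>R u \<in> K" "0 \<le> radial K u" by (auto simp: radial_def)
  show "\<And>t. 0 \<le> t \<Longrightarrow> t *\<^sub>R u \<in> K \<Longrightarrow> t \<le> radial K u"
    unfolding radial_def using bdd by (auto intro: cSup_upper)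
qed

lemma radial_pos:
  assumes "compact K" "0 \<in> interior K"
  obtains e where "0 < e" "\<And>u. norm u = 1 \<Longrightarrow> e *\<^sub>R u \<in> K" "\<And>u. norm u = 1 \<Longrightarrow> e \<le> radial K u"
proof -
  obtain e where e: "0 < e" "cball 0 e \<subseteq> K"
    using assms(2) by (auto simp: mem_interior_cball)
  have in_K: "e *\<^sub>R u \<in> K" if "norm u = 1" for u
    using e that by (intro subsetD[OF e(2)]) auto
  have "0 \<in> K" using assms(2) interior_subset by blast
  then show ?thesis
    using that[of e] in_K e(1) radial_in(3)[OF assms(1)] by (simp add: less_imp_le)
qed

text \<open>
  The normal at \<open>radial K u *\<^sub>R u\<close> comes from a supporting hyperplane, and the direction \<open>u\<close> in which
  \<open>support_fun K v\<close> is attained is that of a point of \<open>K\<close> that is extremal in direction \<open>v\<close>.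
\<close>

lemma convex_body_radial_support_pair:
  assumes "K \<in> convex_bodies_o"
  obtains r R where "radial_support_pair r R (radial K) (support_fun K)"
proof -
  have K: "compact K" "convex K" "0 \<in> interior K"
    using assms by (auto simp: convex_bodies_o_def)
  have 0: "0 \<in> K" using K(3) interior_subset by blast
  obtain e where e: "0 < e" "\<And>u. norm u = 1 \<Longrightarrow> e *\<^sub>R u \<in> K" "\<And>u. norm u = 1 \<Longrightarrow> e \<le> radial K u"
    using radial_pos[OF K(1,3)] by metis
  note rad = radial_in[OF K(1) 0]
  have A: "radial K u * (u \<bullet> v) \<le> support_fun K v" if "norm u = 1" for u v
    using support_fun_upper[OF K(1) rad(1)[OF that], of v] by (simp add: inner_commute)
  have B: "\<exists>v. norm v = 1 \<and> radial K u * (u \<bullet> v) = support_fun K v" if u: "norm u = 1" for u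
  proof -
    let ?x = "radial K u *\<^sub>R u"
    have "?x \<notin> interior K"
    proof
      assume "?x \<in> interior K"
      then obtain d where d: "0 < d" "cball ?x d \<subseteq> K" by (auto simp: mem_interior_cball)
      have "(radial K u + d) *\<^sub>R u \<in> K"
        using d u by (intro subsetD[OF d(2)]) (auto simp: dist_norm algebra_simps)
      then show False using rad(3)[OF u, of "radial K u + d"] rad(2)[OF u] d(1) by simp
    qed
    then have "?x \<notin> rel_interior K"
      using K(3) rel_interior_nonempty_interior by blast
    then obtain a where a: "a \<noteq> 0" "\<And>y. y \<in> K \<Longrightarrow> a \<bullet> ?x \<le> a \<bullet> y"
      using supporting_hyperplane_rel_boundary[OF K(2) rad(1)[OF u]] by metis
    define v where "v = - (a /\<^sub>R norm a)"
    have v: "norm v = 1" using a(1) by (simp add: v_def)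
    have "v \<bullet> y \<le> v \<bullet> ?x" if "y \<in> K" for y
      using a(2)[OF that] a(1) by (simp add: v_def divide_simps)
    then have "support_fun K v = v \<bullet> ?x" by (intro support_fun_eqI rad(1) u)
    then show ?thesis using v by (auto simp: inner_commute)
  qed
  have h_pos: "e \<le> support_fun K v" if "norm v = 1" for v
    using support_fun_upper[OF K(1) e(2)[OF that], of v] that by (simp add: norm_eq_1)
  have C: "\<exists>u. norm u = 1 \<and> radial K u * (u \<bullet> v) = support_fun K v" if v: "norm v = 1" for v
  proof -
    have "\<exists>x\<in>K. \<forall>y\<in>K. v \<bullet> y \<le> v \<bullet> x"
      using 0 K(1) by (intro continuous_attains_sup continuous_intros) auto
    then obtain x where x: "x \<in> K" "support_fun K v = v \<bullet> x" using support_fun_eqI by metis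
    have "0 < v \<bullet> x" using h_pos[OF v] e(1) x(2) by simp
    then have nx: "0 < norm x" by auto
    define u where "u = x /\<^sub>R norm x"
    have u: "norm u = 1" "x = norm x *\<^sub>R u" using nx by (auto simp: u_def)
    have "norm x \<le> radial K u" using rad(3)[OF u(1), of "norm x"] u(2) x(1) by simp
    moreover have "0 < u \<bullet> v" using \<open>0 < v \<bullet> x\<close> nx
      by (simp add: u_def inner_commute)
    ultimately have "norm x * (u \<bullet> v) \<le> radial K u * (u \<bullet> v)" by (intro mult_right_mono) auto
    moreover have "norm x * (u \<bullet> v) = support_fun K v"
      by (subst x(2), subst u(2)) (simp add: inner_commute)
    ultimately show ?thesis using A[OF u(1), of v] u(1) by (intro exI[of _ u]) simp
  qed
  obtain R where R: "\<And>x. x \<in> K \<Longrightarrow> norm x \<le> R"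
    using K(1) compact_imp_bounded bounded_iff by metis
  have \<rho>R: "radial K u \<le> R" if "norm u = 1" for u
    using R[OF rad(1)[OF that]] rad(2)[OF that] that by simp
  have hR: "support_fun K v \<le> R" if v: "norm v = 1" for v
  proof -
    obtain u where u: "norm u = 1" "radial K u * (u \<bullet> v) = support_fun K v" using C v by blast
    have "radial K u * (u \<bullet> v) \<le> radial K u * 1"
      using rad(2)[OF u(1)] inner_le_one[OF u(1) v] by (intro mult_left_mono) auto
    then show ?thesis using \<rho>R[OF u(1)] u(2) by simp
  qed
  show ?thesis
    by (rule that[of e R])
      (use A B C hR \<rho>R h_pos e in \<open>auto simp: radial_support_pair_def Bex_def\<close>)
qed

text \<open>
  \<open>h\<close> is a supremum of the functions \<open>v \<mapsto> \<rho> u * (u \<bullet> v)\<close>, each of which is \<open>R\<close>-Lipschitz.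
\<close>

lemma radial_support_pair_support_lipschitz:
  assumes P: "radial_support_pair r R \<rho> h" and v: "norm v = 1" and w: "norm w = 1"
  shows "\<bar>h v - h w\<bar> \<le> R * norm (v - w)"
proof -
  have *: "h v - h w \<le> R * norm (v - w)" if v: "norm v = 1" and w: "norm w = 1" for v w
  proof -
    obtain u where u: "norm u = 1" "\<rho> u * (u \<bullet> v) = h v"
      using radial_support_pairD(8)[OF P v] by blast
    have "h v - h w \<le> \<rho> u * (u \<bullet> (v - w))"
      using u(2) radial_support_pairD(6)[OF P u(1) w] by (simp add: inner_diff_right algebra_simps)
    also have "\<dots> \<le> \<rho> u * norm (v - w)"
      using radial_support_pair_pos(1)[OF P u(1)] norm_cauchy_schwarz[of u "v - w"] u(1)
      by (intro mult_left_mono) auto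
    also have "\<dots> \<le> R * norm (v - w)"
      using radial_support_pairD(3)[OF P u(1)] by (intro mult_right_mono) auto
    finally show ?thesis .
  qed
  show ?thesis using *[OF v w] *[OF w v] by (simp add: norm_minus_commute abs_le_iff)
qed

lemma radial_support_pair_polar:
  assumes P: "radial_support_pair r R \<rho> h"
  shows "radial_support_pair (1 / R) (1 / r) (\<lambda>v. 1 / h v) (\<lambda>u. 1 / \<rho> u)"
proof -
  note D = radial_support_pairD[OF P] and pos = radial_support_pair_pos[OF P]
  obtain u0 :: 'a where "norm u0 = 1" using norm_Basis SOME_Basis by blast
  then have "0 < R" using pos(1) D(3) by force
  moreover have "1 / h u * (u \<bullet> v) \<le> 1 / \<rho> v" if "norm u = 1" "norm v = 1" for u v
    using D(6)[OF that(2,1)] pos that by (simp add: divide_simps mult.commute inner_commute)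
  moreover have "\<exists>v. norm v = 1 \<and> 1 / h u * (u \<bullet> v) = 1 / \<rho> v" if u: "norm u = 1" for u
    using D(8)[OF u] pos u by (fastforce simp: divide_simps mult.commute inner_commute)
  moreover have "\<exists>u. norm u = 1 \<and> 1 / h u * (u \<bullet> v) = 1 / \<rho> v" if v: "norm v = 1" for v
    using D(7)[OF v] pos v by (fastforce simp: divide_simps mult.commute inner_commute)
  moreover have "1 / R \<le> 1 / h u \<and> 1 / h u \<le> 1 / r \<and> 1 / R \<le> 1 / \<rho> u \<and> 1 / \<rho> u \<le> 1 / r" 
    if "norm u = 1" for u
    using D(1-5) pos that by (intro conjI frac_le) auto
  ultimately show ?thesis
    unfolding radial_support_pair_def Bex_def by auto
qed

text \<open>
  By polarity, \<open>1 / \<rho>\<close> is a support function and has Lipschitz constant \<open>1 / r\<close>.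
\<close>

lemma radial_support_pair_radial_lipschitz:
  assumes P: "radial_support_pair r R \<rho> h" and u: "norm u = 1" and w: "norm w = 1"
  shows "\<bar>\<rho> u - \<rho> w\<bar> \<le> R\<^sup>2 / r * norm (u - w)"
proof -
  note D = radial_support_pairD[OF P] and pos = radial_support_pair_pos[OF P]
  have "0 \<le> R" using pos(1)[OF u] D(3)[OF u] by linarith
  have lip: "\<bar>1 / \<rho> u - 1 / \<rho> w\<bar> \<le> 1 / r * norm (u - w)"
    by (rule radial_support_pair_support_lipschitz[OF radial_support_pair_polar[OF P] u w])
  have "\<rho> u - \<rho> w = - (\<rho> u * \<rho> w * (1 / \<rho> u - 1 / \<rho> w))"
    using pos(1)[OF u] pos(1)[OF w] by (simp add: field_simps)
  then have "\<bar>\<rho> u - \<rho> w\<bar> = (\<rho> u * \<rho> w) * \<bar>1 / \<rho> u - 1 / \<rho> w\<bar>"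
    using pos(1)[OF u] pos(1)[OF w] by (simp add: abs_mult)
  also have "\<dots> \<le> (\<rho> u * \<rho> w) * (1 / r * norm (u - w))"
    using pos(1)[OF u] pos(1)[OF w] lip by (intro mult_left_mono) auto
  also have "\<dots> \<le> (R * R) * (1 / r * norm (u - w))"
    using D(1,3) pos(1) u w \<open>0 \<le> R\<close> by (intro mult_right_mono mult_mono) (auto simp: less_imp_le)
  finally show ?thesis by (simp add: power2_eq_square)
qed

lemma radial_support_pair_continuous:
  assumes P: "radial_support_pair r R \<rho> h"
  shows "continuous_on (sphere 0 1) \<rho>" and "continuous_on (sphere 0 1) h"
proof -
  obtain u0 :: 'a where "norm u0 = 1" using norm_Basis SOME_Basis by blast
  then have R: "0 < R" using radial_support_pair_pos(1)[OF P] radial_support_pairD(3)[OF P] by force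
  have "(R\<^sup>2 / r)-lipschitz_on (sphere 0 1) \<rho>" 
    using radial_support_pair_radial_lipschitz[OF P] radial_support_pairD(1)[OF P]
    by (intro lipschitz_onI) (auto simp: dist_norm)
  then show "continuous_on (sphere 0 1) \<rho>" by (rule lipschitz_on_continuous_on)
  have "R-lipschitz_on (sphere 0 1) h"
    using radial_support_pair_support_lipschitz[OF P] R
    by (intro lipschitz_onI) (auto simp: dist_norm)
  then show "continuous_on (sphere 0 1) h" by (rule lipschitz_on_continuous_on)
qed

text \<open>
  This reduces Hausdorff convergence to uniform convergence of the radial functions.
\<close>

lemma support_diff_le_radial_diff:
  assumes P1: "radial_support_pair r1 R1 \<rho>1 h1" and P2: "radial_support_pair r2 R2 \<rho>2 h2"
    and d: "\<And>u. norm u = 1 \<Longrightarrow> \<bar>\<rho>1 u - \<rho>2 u\<bar> \<le> d" and v: "norm v = 1"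
  shows "\<bar>h1 v - h2 v\<bar> \<le> d"
proof -
  have *: "h1 v - h2 v \<le> d" if P1: "radial_support_pair r1 R1 \<rho>1 h1" and P2: "radial_support_pair r2 R2 \<rho>2 h2"
    and d: "\<And>u. norm u = 1 \<Longrightarrow> \<bar>\<rho>1 u - \<rho>2 u\<bar> \<le> d" for \<rho>1 \<rho>2 h1 h2 r1 R1 r2 R2
  proof -
    obtain u where u: "norm u = 1" "\<rho>1 u * (u \<bullet> v) = h1 v"
      using radial_support_pairD(8)[OF P1 v] by blast
    have "h1 v - h2 v \<le> (\<rho>1 u - \<rho>2 u) * (u \<bullet> v)"
      using u(2) radial_support_pairD(6)[OF P2 u(1) v] by (simp add: algebra_simps)
    also have "\<dots> \<le> \<bar>\<rho>1 u - \<rho>2 u\<bar> * \<bar>u \<bullet> v\<bar>" by (metis abs_ge_self abs_mult)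
    also have "\<dots> \<le> d * 1"
      using d[OF u(1)] Cauchy_Schwarz_ineq2[of u v] u(1) v by (intro mult_mono) auto
    finally show ?thesis by simp
  qed
  show ?thesis using *[OF P1 P2 d] *[OF P2 P1] d by (auto simp: abs_le_iff abs_minus_commute)
qed

section \<open>Uniqueness of the maximiser of a linear functional for almost every direction\<close>

text \<open>
  The translates of a bounded piece of \<open>S\<close> by the vectors \<open>e /\<^sub>R real (Suc k)\<close> are pairwise disjoint,
  have the same measure and stay in a bounded set, so that measure is zero.
\<close>

lemma negligible_transversal:
  fixes S :: "'a::euclidean_space set"
  assumes "closed S" and e: "e \<noteq> 0"
    and line: "\<And>x t. x \<in> S \<Longrightarrow> x + t *\<^sub>R e \<in> S \<Longrightarrow> t = 0"
  shows "negligible S"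
proof -
  have "S \<inter> cball 0 (real m) \<in> null_sets lborel" for m
  proof -
    let ?B = "S \<inter> cball 0 (real m)"
    define A where "A k = (+) ((1 / real (Suc k)) *\<^sub>R e) ` ?B" for k
    have B: "compact ?B" using assms(1) by (simp add: closed_Int_compact)
    have A: "compact (A k)" for k unfolding A_def using B by (rule compact_translation)
    have "disjoint_family A"
      unfolding disjoint_family_on_def
    proof (intro ballI impI)
      fix j k :: nat assume "j \<noteq> k"
      show "A j \<inter> A k = {}"
      proof (rule ccontr)
        assume "A j \<inter> A k \<noteq> {}"
        then obtain x y where xy: "x \<in> S" "y \<in> S"
          "(1 / real (Suc j)) *\<^sub>R e + x = (1 / real (Suc k)) *\<^sub>R e + y"
          unfolding A_def by auto
        then have "y = x + (1 / real (Suc j) - 1 / real (Suc k)) *\<^sub>R e"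
          by (simp add: algebra_simps)
        then have "1 / real (Suc j) - 1 / real (Suc k) = 0" using line xy(1,2) by blast
        then show False using \<open>j \<noteq> k\<close> by simp
      qed
    qed
    moreover have "range A \<subseteq> sets lborel" using A by (auto intro: borel_compact)
    ultimately have sum: "(\<Sum>k. emeasure lborel (A k)) = emeasure lborel (\<Union>k. A k)"
      by (rule suminf_emeasure[symmetric, THEN sym, rotated])
    have "(\<Union>k. A k) \<subseteq> cball 0 (m + norm e)"
    proof
      fix z assume "z \<in> (\<Union>k. A k)"
      then obtain k where "z \<in> A k" by blast
      then obtain x where z: "norm x \<le> m" "z = (1 / real (Suc k)) *\<^sub>R e + x"
        unfolding A_def by auto
      have "norm z \<le> norm ((1 / real (Suc k)) *\<^sub>R e) + norm x" unfolding z by (rule norm_triangle_ineq)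
      also have "norm ((1 / real (Suc k)) *\<^sub>R e) \<le> norm e"
        by (simp add: divide_simps mult_le_cancel_left1)
      finally show "z \<in> cball 0 (m + norm e)" using z(1) by simp
    qed
    then have "emeasure lborel (\<Union>k. A k) \<le> emeasure lborel (cball (0::'a) (m + norm e))"
      by (intro emeasure_mono) auto
    also have "\<dots> < \<infinity>" by (rule emeasure_lborel_cball_finite)
    finally have fin: "(\<Sum>k. emeasure lborel (A k)) < \<infinity>" using sum by simp
    have lmeas: "emeasure lborel C = ennreal (measure lebesgue C)" if "compact C" for C :: "'a set"
      using emeasure_eq_measure2[OF lmeasurable_compact[OF that]] that by (simp add: borel_compact)
    have "emeasure lborel (A k) = ennreal (measure lebesgue ?B)" for k
      using lmeas[OF A, of k] unfolding A_def measure_translation .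
    then have "(\<Sum>k::nat. ennreal (measure lebesgue ?B)) \<noteq> top" using fin by simp
    then have "summable (\<lambda>k::nat. measure lebesgue ?B)"
      by (intro summable_suminf_not_top) auto
    then have "emeasure lborel ?B = 0" using lmeas[OF B] by (simp add: summable_const_iff)
    then show ?thesis using B by (auto simp: null_sets_def borel_compact)
  qed
  then have "(\<Union>m. S \<inter> cball 0 (real m)) \<in> null_sets lborel" by blast
  also have "(\<Union>m. S \<inter> cball 0 (real m)) = S" by (auto intro: real_arch_simple)
  finally show ?thesis 
    using negligible_iff_null_sets null_sets_completionI by blast
qed

text \<open>
  The points at which the support function of \<open>P\<close> has a subgradient \<open>y\<close> with \<open>y \<bullet> e \<le> a\<close> and another
  one with \<open>b \<le> y \<bullet> e\<close>. For \<open>a < b\<close> these are points of non-differentiability.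
\<close>

definition kink_set :: "'a::euclidean_space set \<Rightarrow> 'a \<Rightarrow> real \<Rightarrow> real \<Rightarrow> 'a set" where
  "kink_set P e a b =
     {x. \<exists>y\<in>P. (\<forall>z\<in>P. x \<bullet> z \<le> x \<bullet> y) \<and> y \<bullet> e \<le> a} \<inter>
     {x. \<exists>y\<in>P. (\<forall>z\<in>P. x \<bullet> z \<le> x \<bullet> y) \<and> b \<le> y \<bullet> e}"

lemma closed_kink_set:
  assumes "compact P" shows "closed (kink_set P e a b)"
proof -
  have *: "closed {p. \<forall>z\<in>P. snd p \<bullet> z \<le> snd p \<bullet> fst p}" (is "closed ?M")
  proof -
    have "?M = (\<Inter>z\<in>P. {p. snd p \<bullet> z \<le> snd p \<bullet> fst p})" by auto
    also have "closed \<dots>" by (intro closed_INT ballI closed_Collect_le continuous_intros)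
    finally show ?thesis .
  qed
  have "closed (?M \<inter> {p. fst p \<bullet> e \<le> a})" "closed (?M \<inter> {p. b \<le> fst p \<bullet> e})"
    by (intro closed_Int * closed_Collect_le continuous_intros)+
  from closed_compact_projection[OF assms this(1)] closed_compact_projection[OF assms this(2)]
  show ?thesis unfolding kink_set_def by (auto simp: Bex_def intro: closed_Int)
qed

text \<open>
  Subgradients are monotone: moving from \<open>x\<close> in the direction \<open>e\<close> cannot decrease \<open>y \<bullet> e\<close>.
  So a line of direction \<open>e\<close> jumps over the gap between \<open>a\<close> and \<open>b\<close> at most once.
\<close>

lemma negligible_kink_set:
  assumes "compact P" "a < b" "e \<noteq> 0" shows "negligible (kink_set P e a b)"
proof (rule negligible_transversal[OF closed_kink_set[OF assms(1)] assms(3)])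
  have no: False if x: "x \<in> kink_set P e a b" "x + t *\<^sub>R e \<in> kink_set P e a b" and "0 < t" for x t
  proof -
    obtain y where y: "y \<in> P" "\<And>z. z \<in> P \<Longrightarrow> x \<bullet> z \<le> x \<bullet> y" "b \<le> y \<bullet> e"
      using x(1) by (auto simp: kink_set_def)
    obtain y' where y': "y' \<in> P" "\<And>z. z \<in> P \<Longrightarrow> (x + t *\<^sub>R e) \<bullet> z \<le> (x + t *\<^sub>R e) \<bullet> y'" "y' \<bullet> e \<le> a"
      using x(2) by (auto simp: kink_set_def)
    have "t * (e \<bullet> y) \<le> t * (e \<bullet> y')"
      using y(2)[OF y'(1)] y'(2)[OF y(1)] by (simp add: inner_add_left)
    then show False using \<open>0 < t\<close> y(3) y'(3) assms(2) by (simp add: inner_commute)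
  qed
  fix x t assume x: "x \<in> kink_set P e a b" "x + t *\<^sub>R e \<in> kink_set P e a b"
  show "t = 0"
  proof (rule ccontr)
    assume "t \<noteq> 0"
    then consider "t > 0" | "- t > 0" by linarith
    then show False
    proof cases
      case 1 then show False using no x by blast
    next
      case 2 then show False using no[of "x + t *\<^sub>R e" "- t"] x by (simp add: algebra_simps)
    qed
  qed
qed

lemma kink_set_scaleR:
  assumes "0 < c" "c *\<^sub>R x \<in> kink_set P e a b" shows "x \<in> kink_set P e a b"
  using assms by (auto simp: kink_set_def)

text \<open>
  Two distinct maximisers differ in some coordinate \<open>e\<close>, and two rationals fit between their
  \<open>e\<close>-coordinates; so countably many kink sets cover all points without a unique maximiser.
\<close>

lemma two_maximizers_in_kink_set:
  assumes y: "y \<in> P" "\<And>z. z \<in> P \<Longrightarrow> x \<bullet> z \<le> x \<bullet> y"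
    and y': "y' \<in> P" "\<And>z. z \<in> P \<Longrightarrow> x \<bullet> z \<le> x \<bullet> y'"
    and ne: "y \<noteq> y'"
  shows "\<exists>e\<in>Basis. \<exists>a\<in>\<rat>. \<exists>b\<in>\<rat>. a < b \<and> x \<in> kink_set P e a b"
proof -
  have wlog: "\<exists>a\<in>\<rat>. \<exists>b\<in>\<rat>. a < b \<and> x \<in> kink_set P e a b"
    if lt: "y1 \<bullet> e < y2 \<bullet> e" and "y1 \<in> P" "\<forall>z\<in>P. x \<bullet> z \<le> x \<bullet> y1" "y2 \<in> P" "\<forall>z\<in>P. x \<bullet> z \<le> x \<bullet> y2"
    for e y1 y2
  proof -
    obtain a where a: "a \<in> \<rat>" "y1 \<bullet> e < a" "a < y2 \<bullet> e"
      using Rats_dense_in_real[OF lt] by metis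
    obtain b where b: "b \<in> \<rat>" "a < b" "b < y2 \<bullet> e"
      using Rats_dense_in_real[OF a(3)] by metis
    have "x \<in> kink_set P e a b"
      unfolding kink_set_def Int_iff mem_Collect_eq
      using a b that by (intro conjI bexI[of _ y1] bexI[of _ y2]) auto
    then show ?thesis using a b by blast
  qed
  obtain e where e: "e \<in> Basis" "y \<bullet> e \<noteq> y' \<bullet> e" using ne euclidean_eqI by blast
  then consider "y \<bullet> e < y' \<bullet> e" | "y' \<bullet> e < y \<bullet> e" by linarith
  then show ?thesis using wlog[of y e y'] wlog[of y' e y] assms e(1) by cases blast+
qed

section \<open>Spherical Lebesgue measure\<close>

lemma direction_measurable:
  "(\<lambda>x. x /\<^sub>R norm x) \<in> measurable (restrict_space lborel (ball 0 1 - {0})) (sphere_borel :: 'a::euclidean_space measure)"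
  unfolding sphere_borel_def
  by (intro measurable_restrict_space3) (auto)

lemma space_sphere_borel [simp]: "space sphere_borel = sphere 0 1"
  by (simp add: sphere_borel_def space_restrict_space)

lemma space_spherical_lebesgue [simp]: "space spherical_lebesgue = sphere 0 1"
  by (simp add: spherical_lebesgue_def space_scale_measure)

lemma sphere_closed_sets: "closed C \<Longrightarrow> C \<inter> sphere 0 1 \<in> sets sphere_borel"
  unfolding sphere_borel_def sets_restrict_space by (subst Int_commute) (intro imageI borel_closed)

lemma emeasure_spherical_lebesgue:
  fixes A :: "'a::euclidean_space set"
  assumes A: "A \<in> sets sphere_borel"
  shows "emeasure spherical_lebesgue A = of_nat DIM('a) * 
    emeasure lborel {x \<in> ball 0 1 - {0}. x /\<^sub>R norm x \<in> A}"
proof -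
  have eq: "(\<lambda>x. x /\<^sub>R norm x) -` A \<inter> (ball 0 1 - {0}) = {x \<in> ball 0 1 - {0}. x /\<^sub>R norm x \<in> A}"
    by auto
  have "emeasure spherical_lebesgue A = of_nat DIM('a) *
     emeasure (distr (restrict_space lborel (ball 0 1 - {0})) sphere_borel (\<lambda>x. x /\<^sub>R norm x)) A"
    using A by (simp add: spherical_lebesgue_def)
  also have "\<dots> = of_nat DIM('a) * emeasure (restrict_space lborel (ball 0 1 - {0}))
       {x \<in> ball 0 1 - {0}. x /\<^sub>R norm x \<in> A}"
    using A by (subst emeasure_distr[OF direction_measurable]) (auto simp: space_restrict_space eq)
  also have "\<dots> = of_nat DIM('a) * emeasure lborel {x \<in> ball 0 1 - {0}. x /\<^sub>R norm x \<in> A}"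
    by (subst emeasure_restrict_space) auto
  finally show ?thesis .
qed

lemma finite_measure_spherical_lebesgue: "finite_measure (spherical_lebesgue :: 'a::euclidean_space measure)"
proof (rule finite_measureI)
  have "sphere 0 1 \<in> sets (sphere_borel :: 'a measure)"
    using sets.top[of sphere_borel] by simp
  moreover have "emeasure lborel {x \<in> ball 0 1 - {0::'a}. x /\<^sub>R norm x \<in> sphere 0 1}
     \<le> emeasure lborel (ball 0 1 :: 'a set)"
    by (intro emeasure_mono) auto
  then have "emeasure lborel {x \<in> ball 0 1 - {0::'a}. x /\<^sub>R norm x \<in> sphere 0 1} < \<infinity>"
    using emeasure_lborel_ball_finite[of "0::'a" 1] by (simp add: order.strict_trans1)
  ultimately show "emeasure spherical_lebesgue (space spherical_lebesgue :: 'a set) \<noteq> \<infinity>"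
    by (simp add: emeasure_spherical_lebesgue ennreal_mult_eq_top_iff del: mem_sphere)
qed

text \<open>
  A kink set is a cone, so the cone over its trace on the sphere is again negligible.
\<close>

lemma spherical_lebesgue_AE_not_kink:
  assumes "compact P" "a < b" "e \<noteq> 0"
  shows "AE u in spherical_lebesgue. u \<notin> kink_set P e a b"
proof -
  let ?A = "kink_set P e a b \<inter> sphere 0 1"
  have A: "?A \<in> sets sphere_borel" using closed_kink_set[OF assms(1)] by (rule sphere_closed_sets)
  have "kink_set P e a b \<in> null_sets lborel"
    using negligible_kink_set[OF assms] closed_kink_set[OF assms(1)]
    by (simp add: negligible_iff_null_sets null_sets_completion_iff)
  moreover have "{x \<in> ball 0 1 - {0}. x /\<^sub>R norm x \<in> ?A} \<subseteq> kink_set P e a b"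
    using kink_set_scaleR[of "inverse (norm _)"] by auto
  ultimately have "emeasure lborel {x \<in> ball 0 1 - {0}. x /\<^sub>R norm x \<in> ?A} \<le> 0"
    using emeasure_mono[of "{x \<in> ball 0 1 - {0}. x /\<^sub>R norm x \<in> ?A}" "kink_set P e a b" lborel]
    by (simp add: null_sets_def)
  then have "?A \<in> null_sets spherical_lebesgue"
    using A emeasure_spherical_lebesgue[OF A]
    by (intro null_setsI) (simp_all add: spherical_lebesgue_def)
  then have "AE u in spherical_lebesgue. u \<notin> ?A" by (rule AE_not_in)
  then show ?thesis by (rule AE_mp) (auto intro!: AE_I2)
qed

lemma spherical_lebesgue_unique_maximizer:
  assumes "compact P"
  shows "AE u in spherical_lebesgue. \<forall>y\<in>P. \<forall>y'\<in>P.
    (\<forall>z\<in>P. u \<bullet> z \<le> u \<bullet> y) \<longrightarrow> (\<forall>z\<in>P. u \<bullet> z \<le> u \<bullet> y') \<longrightarrow> y = y'"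
proof -
  have "AE u in spherical_lebesgue. \<forall>e\<in>Basis. \<forall>a\<in>\<rat>. \<forall>b\<in>\<rat>. a < b \<longrightarrow> u \<notin> kink_set P e a b"
    using spherical_lebesgue_AE_not_kink[OF assms]
    by (intro AE_ball_countable' countable_rat countable_finite finite_Basis AE_impI)
      (auto simp: nonzero_Basis)
  then show ?thesis
  proof (rule AE_mp, intro AE_I2 impI ballI)
    fix u y y' assume "\<forall>e\<in>Basis. \<forall>a\<in>\<rat>. \<forall>b\<in>\<rat>. a < b \<longrightarrow> u \<notin> kink_set P e a b"
      and "y \<in> P" "y' \<in> P" "\<forall>z\<in>P. u \<bullet> z \<le> u \<bullet> y" "\<forall>z\<in>P. u \<bullet> z \<le> u \<bullet> y'"
    then show "y = y'" using two_maximizers_in_kink_set[of y P u y'] by blast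
  qed
qed

text \<open>
  The cone over a nonempty relatively open subset of the sphere is open and nonempty.
\<close>

lemma spherical_lebesgue_open_pos:
  fixes U :: "'a::euclidean_space set"
  assumes "open U" "u \<in> U" "norm u = 1"
  shows "0 < emeasure spherical_lebesgue (U \<inter> sphere 0 1)"
proof -
  have U: "U \<inter> sphere 0 1 \<in> sets sphere_borel"
    unfolding sphere_borel_def sets_restrict_space using assms(1)
    by (subst Int_commute) (intro imageI borel_open)
  let ?V = "{x \<in> ball 0 1 - {0}. x /\<^sub>R norm x \<in> U \<inter> sphere 0 1}"
  have V: "?V = (ball 0 1 - {0}) \<inter> (\<lambda>x. x /\<^sub>R norm x) -` U" by auto
  have "open ?V" unfolding V using assms(1)
    by (intro continuous_open_preimage continuous_intros open_delete) auto
  moreover have "(1/2) *\<^sub>R u \<in> ?V" using assms by auto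
  ultimately have "\<not> negligible ?V" using open_not_negligible by blast
  then have "emeasure lborel ?V \<noteq> 0" using \<open>open ?V\<close>
    by (auto simp: null_sets_def negligible_iff_null_sets null_sets_completion_iff simp del: mem_sphere Int_iff)
  then show ?thesis unfolding emeasure_spherical_lebesgue[OF U]
    by (simp add: ennreal_zero_less_mult_iff zero_less_iff_neq_zero)
qed

section \<open>The outer normal at a boundary point\<close>

text \<open>
  The vectors \<open>v /\<^sub>R h v\<close> are the boundary points of the polar body, and \<open>\<rho> u * (u \<bullet> v) = h v\<close> says
  that \<open>v /\<^sub>R h v\<close> maximises the inner product with \<open>u\<close> over them.
\<close>

lemma radial_support_pair_AE_unique_normal:
  assumes P: "radial_support_pair r R \<rho> h"
  shows "AE u in spherical_lebesgue. \<forall>v\<in>sphere 0 1. \<forall>w\<in>sphere 0 1.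
    \<rho> u * (u \<bullet> v) = h v \<longrightarrow> \<rho> u * (u \<bullet> w) = h w \<longrightarrow> v = w"
proof -
  note D = radial_support_pairD[OF P] and pos = radial_support_pair_pos[OF P]
  define y where "y v = (1 / h v) *\<^sub>R v" for v
  define B where "B = y ` sphere 0 1"
  have "\<forall>v\<in>sphere 0 1. h v \<noteq> 0" using pos(2) by force
  then have "continuous_on (sphere 0 1) y"
    unfolding y_def using radial_support_pair_continuous(2)[OF P]
    by (intro continuous_on_scaleR continuous_on_divide continuous_on_const continuous_on_id)
  then have "compact B"
    unfolding B_def by (intro compact_continuous_image compact_sphere)
  have max: "\<forall>z\<in>B. u \<bullet> z \<le> u \<bullet> y v"
    if "norm u = 1" "norm v = 1" "\<rho> u * (u \<bullet> v) = h v" for u v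
  proof -
    have *: "u \<bullet> y v = 1 / \<rho> u"
      using that(3)[symmetric] pos[OF that(1)] pos(2)[OF that(2)] by (auto simp: y_def)
    have "u \<bullet> y w \<le> 1 / \<rho> u" if "norm w = 1" for w
      using D(6)[OF \<open>norm u = 1\<close> that] pos(1)[OF \<open>norm u = 1\<close>] pos(2)[OF that]
      by (simp add: y_def field_simps)
    then show ?thesis unfolding * B_def by auto
  qed
  have y_inj: "v = w" if "norm v = 1" "norm w = 1" "y v = y w" for v w
  proof -
    have "norm (y v) = norm (y w)" using that by simp
    then have "h v = h w" using that pos(2)[of v] pos(2)[of w] by (simp add: y_def)
    then show ?thesis using that pos(2)[of v] by (simp add: y_def)
  qed
  have "AE u in spherical_lebesgue. u \<in> sphere 0 1" by (auto intro!: AE_I2)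
  with spherical_lebesgue_unique_maximizer[OF \<open>compact B\<close>] show ?thesis
  proof eventually_elim
    fix u :: 'a assume uniq: "\<forall>y\<in>B. \<forall>y'\<in>B. (\<forall>z\<in>B. u \<bullet> z \<le> u \<bullet> y) \<longrightarrow> (\<forall>z\<in>B. u \<bullet> z \<le> u \<bullet> y') \<longrightarrow> y = y'"
      and u: "u \<in> sphere 0 1"
    show "\<forall>v\<in>sphere 0 1. \<forall>w\<in>sphere 0 1.
      \<rho> u * (u \<bullet> v) = h v \<longrightarrow> \<rho> u * (u \<bullet> w) = h w \<longrightarrow> v = w"
    proof (intro ballI impI)
      fix v w assume vw: "v \<in> sphere 0 1" "w \<in> sphere 0 1"
        "\<rho> u * (u \<bullet> v) = h v" "\<rho> u * (u \<bullet> w) = h w"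
      have "y v = y w"
        using uniq max[of u v] max[of u w] u vw unfolding B_def by auto
      then show "v = w" using y_inj vw by auto
    qed
  qed
qed

definition outer_normal :: "('a::euclidean_space \<Rightarrow> real) \<Rightarrow> ('a \<Rightarrow> real) \<Rightarrow> 'a \<Rightarrow> 'a" where
  "outer_normal \<rho> h u = (SOME v. norm v = 1 \<and> \<rho> u * (u \<bullet> v) = h v)"

lemma outer_normal:
  assumes "radial_support_pair r R \<rho> h" "norm u = 1"
  shows "norm (outer_normal \<rho> h u) = 1"
    and "\<rho> u * (u \<bullet> outer_normal \<rho> h u) = h (outer_normal \<rho> h u)"
  unfolding outer_normal_def using someI_ex[OF radial_support_pairD(7)[OF assms]] by auto

text \<open>
  Up to a null set, the reverse radial Gauss image of \<open>\<eta>\<close> is the preimage of \<open>\<eta>\<close> under the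
  selected outer normal.
\<close>

lemma AE_outer_normal_iff:
  assumes P: "radial_support_pair r R \<rho> h" and "\<eta> \<subseteq> sphere 0 1"
  shows "AE u in spherical_lebesgue.
    (\<exists>v\<in>\<eta>. \<rho> u * (u \<bullet> v) = h v) \<longleftrightarrow> outer_normal \<rho> h u \<in> \<eta>"
proof -
  have "AE u in spherical_lebesgue. u \<in> sphere 0 1" by (auto intro!: AE_I2)
  with radial_support_pair_AE_unique_normal[OF P] show ?thesis
  proof eventually_elim
    case (elim u)
    then have "outer_normal \<rho> h u \<in> sphere 0 1"
      "\<rho> u * (u \<bullet> outer_normal \<rho> h u) = h (outer_normal \<rho> h u)"
      using outer_normal[OF P, of u] by auto
    then show ?case using elim(1) assms(2) by blast
  qed
qed

lemma closed_normal_image: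
  assumes P: "radial_support_pair r R \<rho> h" and "closed C"
  shows "closed {u \<in> sphere 0 1. \<exists>v\<in>C \<inter> sphere 0 1. \<rho> u * (u \<bullet> v) = h v}"
proof -
  let ?S = "sphere (0::'a) 1"
  note cont = radial_support_pair_continuous[OF P]
  have \<rho>: "continuous_on (?S \<times> (C \<inter> ?S)) (\<lambda>p. \<rho> (fst p))"
    by (rule continuous_on_compose2[OF cont(1)]) (auto intro!: continuous_intros)
  have h: "continuous_on (?S \<times> (C \<inter> ?S)) (\<lambda>p. h (snd p))"
    by (rule continuous_on_compose2[OF cont(2)]) (auto intro!: continuous_intros)
  have cpt: "compact (?S \<times> (C \<inter> ?S))"
    using assms(2) by (intro compact_Times closed_Int_compact) auto
  have "continuous_on (?S \<times> (C \<inter> ?S)) (\<lambda>p. \<rho> (fst p) * (fst p \<bullet> snd p) - h (snd p))"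
    by (intro continuous_intros \<rho> h)
  then have "closed ((?S \<times> (C \<inter> ?S)) \<inter> (\<lambda>p. \<rho> (fst p) * (fst p \<bullet> snd p) - h (snd p)) -` {0})"
    using cpt by (intro continuous_closed_preimage compact_imp_closed) auto
  then have "compact ((?S \<times> (C \<inter> ?S)) \<inter> ((?S \<times> (C \<inter> ?S)) \<inter> (\<lambda>p. \<rho> (fst p) * (fst p \<bullet> snd p) - h (snd p)) -` {0}))"
    using cpt by (rule compact_Int_closed[rotated])
  then have "compact (fst ` ((?S \<times> (C \<inter> ?S)) \<inter> (\<lambda>p. \<rho> (fst p) * (fst p \<bullet> snd p) - h (snd p)) -` {0}))"
    by (intro compact_continuous_image continuous_intros) (simp add: Int_assoc)
  also have "fst ` ((?S \<times> (C \<inter> ?S)) \<inter> (\<lambda>p. \<rho> (fst p) * (fst p \<bullet> snd p) - h (snd p)) -` {0})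
      = {u \<in> ?S. \<exists>v\<in>C \<inter> ?S. \<rho> u * (u \<bullet> v) = h v}"
    by (force simp: image_iff)
  finally show ?thesis by (rule compact_imp_closed)
qed

lemma sets_sphere_borel_subset: "sets sphere_borel \<subseteq> sets spherical_lebesgue"
  by (auto simp: spherical_lebesgue_def)

lemma measurable_spherical_lebesgue: "f \<in> measurable sphere_borel N \<Longrightarrow> f \<in> measurable spherical_lebesgue N"
  using sets_sphere_borel_subset by (auto simp: measurable_def)

lemma continuous_on_sphere_measurable:
  fixes f :: "'a::euclidean_space \<Rightarrow> real"
  assumes "continuous_on (sphere 0 1) f"
  shows "f \<in> borel_measurable sphere_borel"
  unfolding sphere_borel_def by (rule borel_measurable_continuous_on_restrict[OF assms])

text \<open>
  The preimage of a closed set differs by a null set from the closed set of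
  \<open>closed_normal_image\<close>, and null sets are harmless because spherical Lebesgue measure is complete.
\<close>

lemma measurable_outer_normal:
  assumes P: "radial_support_pair r R \<rho> h"
  shows "outer_normal \<rho> h \<in> measurable spherical_lebesgue sphere_borel"
proof -
  let ?L = "spherical_lebesgue :: 'a measure" and ?\<alpha> = "outer_normal \<rho> h"
  have complete: "complete_measure ?L" unfolding spherical_lebesgue_def ..
  have closed: "?\<alpha> -` C \<inter> space ?L \<in> sets ?L" if "closed C" for C
  proof (rule complete_measure.in_sets_AE[OF complete])
    let ?A = "{u \<in> sphere 0 1. \<exists>v\<in>C \<inter> sphere 0 1. \<rho> u * (u \<bullet> v) = h v}"
    have "?A \<inter> sphere 0 1 \<in> sets sphere_borel"
      by (rule sphere_closed_sets[OF closed_normal_image[OF P that]])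
    then have "?A \<inter> sphere 0 1 \<in> sets ?L" using sets_sphere_borel_subset by blast
    moreover have "?A \<inter> sphere 0 1 = ?A" by blast
    ultimately show "?A \<in> sets ?L" by simp
    have "AE u in ?L. u \<in> sphere 0 1" by (auto intro!: AE_I2)
    with AE_outer_normal_iff[OF P, of "C \<inter> sphere 0 1", OF Int_lower2]
    show "AE u in ?L. u \<in> ?A \<longleftrightarrow> u \<in> ?\<alpha> -` C \<inter> space ?L"
    proof eventually_elim
      case (elim u)
      then show ?case using outer_normal(1)[OF P, of u] by auto
    qed
  qed auto
  have "?\<alpha> \<in> borel_measurable ?L"
  proof (rule borel_measurableI)
    fix S :: "'a set" assume "open S"
    then have "?\<alpha> -` (- S) \<inter> space ?L \<in> sets ?L" by (intro closed) auto
    then have "space ?L - (?\<alpha> -` (- S) \<inter> space ?L) \<in> sets ?L" by blast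
    also have "space ?L - (?\<alpha> -` (- S) \<inter> space ?L) = ?\<alpha> -` S \<inter> space ?L" by auto
    finally show "?\<alpha> -` S \<inter> space ?L \<in> sets ?L" .
  qed
  then show ?thesis
    unfolding sphere_borel_def using outer_normal(1)[OF P]
    by (intro measurable_restrict_space2) auto
qed

section \<open>Integrals against the dual curvature measure\<close>

text \<open>
  The factor \<open>1 / n\<close> of the dual curvature measure is absorbed here, so that integrals against it
  become integrals of \<open>\<rho> powr q * star_weight q Q\<close> against spherical Lebesgue measure.
\<close>

definition star_weight :: "real \<Rightarrow> 'a::euclidean_space set \<Rightarrow> 'a \<Rightarrow> real" where
  "star_weight q Q u = radial Q u powr (real DIM('a) - q) / real DIM('a)"

lemma star_weight:
  assumes "Q \<in> star_bodies_o"
  shows "continuous_on (sphere 0 1) (star_weight q Q)"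
    and "\<And>u. norm u = 1 \<Longrightarrow> 0 < star_weight q Q u"
proof -
  have Q: "compact Q" "0 \<in> interior Q" "continuous_on (sphere 0 1) (radial Q)"
    using assms by (auto simp: star_bodies_o_def)
  have pos: "0 < radial Q u" if "norm u = 1" for u
    using radial_pos[OF Q(1,2)] that by (metis less_le_trans)
  show "0 < star_weight q Q u" if "norm u = 1" for u
    using pos[OF that] by (simp add: star_weight_def)
  show "continuous_on (sphere 0 1) (star_weight q Q)"
    unfolding star_weight_def using pos
    by (intro continuous_intros Q(3)) force+
qed

lemma continuous_on_radial_weight:
  assumes P: "radial_support_pair r R \<rho> h" and W: "continuous_on (sphere 0 1) W"
  shows "continuous_on (sphere 0 1) (\<lambda>u. \<rho> u powr q * W u)"
  using radial_support_pair_pos(1)[OF P]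
  by (intro continuous_intros radial_support_pair_continuous(1)[OF P] W) force

lemma continuous_on_support_powr:
  assumes P: "radial_support_pair r R \<rho> h"
  shows "continuous_on (sphere 0 1) (\<lambda>v. h v powr s)"
  using radial_support_pair_pos(2)[OF P]
  by (intro continuous_intros radial_support_pair_continuous(2)[OF P]) force

text \<open>
  This also shows that the set function defining the dual curvature measure is countably additive;
  otherwise \<open>measure_of\<close> would return the zero measure.
\<close>

lemma dual_curvature_eq_distr:
  fixes K Q :: "'a::euclidean_space set"
  assumes P: "radial_support_pair r R (radial K) (support_fun K)" and Q: "Q \<in> star_bodies_o"
  shows "dual_curvature q K Q = distr
    (density spherical_lebesgue (\<lambda>u. ennreal (radial K u powr q * star_weight q Q u)))
    sphere_borel (outer_normal (radial K) (support_fun K))" (is "_ = ?M")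
proof -
  let ?\<alpha> = "outer_normal (radial K) (support_fun K)"
  let ?w = "\<lambda>u. radial K u powr q * star_weight q Q u"
  let ?L = "spherical_lebesgue :: 'a measure"
  have w: "?w \<in> borel_measurable ?L"
    by (intro measurable_spherical_lebesgue continuous_on_sphere_measurable
        continuous_on_radial_weight[OF P] star_weight(1) Q)
  note \<alpha> = measurable_outer_normal[OF P]
  have "ennreal (1 / real DIM('a)) * (\<integral>\<^sup>+ u \<in> reverse_radial_gauss K \<eta>.
      ennreal (radial K u powr q * radial Q u powr (real DIM('a) - q)) \<partial>spherical_lebesgue)
    = emeasure ?M \<eta>" if "\<eta> \<in> sigma_sets (sphere 0 1) (sets sphere_borel)" for \<eta>
  proof -
    have \<eta>: "\<eta> \<in> sets sphere_borel"
      using that sets.sigma_sets_eq[of "sphere_borel :: 'a measure"] by simp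
    then have \<eta>S: "\<eta> \<subseteq> sphere 0 1" using sets.sets_into_space by fastforce
    have AE: "AE u in ?L. indicator (reverse_radial_gauss K \<eta>) u =
        (indicator (?\<alpha> -` \<eta> \<inter> space ?L) u :: ennreal)"
    proof -
      have "AE u in ?L. u \<in> sphere 0 1" by (auto intro!: AE_I2)
      with AE_outer_normal_iff[OF P \<eta>S] show ?thesis
        by eventually_elim (auto simp: reverse_radial_gauss_def indicator_def)
    qed
    have meas: "?\<alpha> -` \<eta> \<inter> space ?L \<in> sets ?L" using \<alpha> \<eta> by (rule measurable_sets)
    have "emeasure ?M \<eta> = emeasure (density ?L ?w) (?\<alpha> -` \<eta> \<inter> space ?L)"
      using \<alpha> \<eta> by (subst emeasure_distr) auto
    also have "\<dots> = (\<integral>\<^sup>+u. ennreal (?w u) * indicator (?\<alpha> -` \<eta> \<inter> space ?L) u \<partial>?L)"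
      using w meas by (intro emeasure_density) auto
    also have "\<dots> = (\<integral>\<^sup>+u. ennreal (1 / real DIM('a)) *
      (ennreal (radial K u powr q * radial Q u powr (real DIM('a) - q)) * 
        indicator (?\<alpha> -` \<eta> \<inter> space ?L) u) \<partial>?L)"
      by (intro nn_integral_cong) (auto simp: star_weight_def ennreal_mult[symmetric] mult.assoc[symmetric] simp del: ennreal_mult split: split_indicator)
    also have "\<dots> = ennreal (1 / real DIM('a)) * (\<integral>\<^sup>+u. 
      (ennreal (radial K u powr q * radial Q u powr (real DIM('a) - q)) * 
        indicator (?\<alpha> -` \<eta> \<inter> space ?L) u) \<partial>?L)"
    proof (rule nn_integral_cmult)
      have "(\<lambda>u. real DIM('a) * ?w u) \<in> borel_measurable ?L" using w by simp
      also have "(\<lambda>u. real DIM('a) * ?w u) = (\<lambda>u. radial K u powr q * radial Q u powr (real DIM('a) - q))"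
        by (auto simp: star_weight_def)
      finally show "(\<lambda>u. ennreal (radial K u powr q * radial Q u powr (real DIM('a) - q)) * 
        indicator (?\<alpha> -` \<eta> \<inter> space ?L) u) \<in> borel_measurable ?L"
        using meas by (intro borel_measurable_times_ennreal) auto
    qed
    also have "(\<integral>\<^sup>+u. (ennreal (radial K u powr q * radial Q u powr (real DIM('a) - q)) * 
        indicator (?\<alpha> -` \<eta> \<inter> space ?L) u) \<partial>?L) = (\<integral>\<^sup>+ u \<in> reverse_radial_gauss K \<eta>.
      ennreal (radial K u powr q * radial Q u powr (real DIM('a) - q)) \<partial>?L)"
      by (rule nn_integral_cong_AE) (use AE in eventually_elim, simp)
    finally show ?thesis by simp
  qed
  then have "dual_curvature q K Q = measure_of (space ?M) (sets ?M) (emeasure ?M)"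
    unfolding dual_curvature_def using sets.space_closed[of "sphere_borel :: 'a measure"]
    by (simp, intro measure_of_eq) auto
  then show ?thesis unfolding measure_of_of_measure .
qed

lemma finite_measure_density_bounded:
  assumes "finite_measure M" and g: "g \<in> borel_measurable M" and "\<And>x. x \<in> space M \<Longrightarrow> g x \<le> B"
  shows "finite_measure (density M (\<lambda>x. ennreal (g x)))"
proof (rule finite_measureI)
  interpret finite_measure M by fact
  have "emeasure (density M (\<lambda>x. ennreal (g x))) (space M)
      = (\<integral>\<^sup>+x. ennreal (g x) * indicator (space M) x \<partial>M)"
    using g by (intro emeasure_density) auto
  also have "\<dots> \<le> (\<integral>\<^sup>+x. ennreal B \<partial>M)"
    using assms(3) by (intro nn_integral_mono) (auto intro: ennreal_leI)
  also have "\<dots> < \<infinity>" by (simp add: emeasure_eq_measure ennreal_mult[symmetric] ennreal_mult_less_top)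
  finally show "emeasure (density M (\<lambda>x. ennreal (g x))) (space (density M (\<lambda>x. ennreal (g x)))) \<noteq> \<infinity>"
    by simp
qed

text \<open>
  The \<open>\<sigma>\<close>-algebra may be larger than the Borel one, so that the complete measure
  \<open>spherical_lebesgue\<close> is included.
\<close>

definition sphere_measure :: "'a::euclidean_space measure \<Rightarrow> bool" where
  "sphere_measure M \<longleftrightarrow> finite_measure M \<and> space M = sphere 0 1 \<and> sets sphere_borel \<subseteq> sets M"

lemma sphere_measure_spherical_lebesgue: "sphere_measure (spherical_lebesgue :: 'a::euclidean_space measure)"
  using finite_measure_spherical_lebesgue sets_sphere_borel_subset by (simp add: sphere_measure_def)

lemma continuous_on_sphere_bounded:
  fixes f :: "'a::euclidean_space \<Rightarrow> real"
  assumes "continuous_on (sphere 0 1) f"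
  obtains B where "\<And>u. norm u = 1 \<Longrightarrow> \<bar>f u\<bar> \<le> B"
proof -
  have "bounded (f ` sphere 0 1)"
    using assms by (intro compact_imp_bounded compact_continuous_image) auto
  then obtain B where "\<forall>y\<in>f ` sphere 0 1. norm y \<le> B" unfolding bounded_iff by blast
  then show ?thesis using that[of B] by auto
qed

text \<open>
  The integral is pulled back along the outer normal map; its integrand is then a bounded function
  of the direction \<open>u\<close>.
\<close>

lemma
  fixes K Q :: "'a::euclidean_space set"
  assumes P: "radial_support_pair r R (radial K) (support_fun K)" and Q: "Q \<in> star_bodies_o"
  shows integral_Lp_dual_curvature: "continuous_on (sphere 0 1) f \<Longrightarrow>
      (\<integral>v. f v \<partial>Lp_dual_curvature p q K Q) =
      (\<integral>u. f (outer_normal (radial K) (support_fun K) u)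
         * (support_fun K (outer_normal (radial K) (support_fun K) u) powr (- p)
         * (radial K u powr q * star_weight q Q u)) \<partial>spherical_lebesgue)"
    and sphere_measure_Lp_dual_curvature: "sphere_measure (Lp_dual_curvature p q K Q)"
proof -
  let ?\<alpha> = "outer_normal (radial K) (support_fun K)"
  let ?w = "\<lambda>u. radial K u powr q * star_weight q Q u"
  let ?g = "\<lambda>v. support_fun K v powr (- p)"
  let ?L = "spherical_lebesgue :: 'a measure"
  let ?D = "distr (density ?L (\<lambda>u. ennreal (?w u))) sphere_borel ?\<alpha>"
  have wc: "continuous_on (sphere 0 1) ?w"
    by (intro continuous_on_radial_weight[OF P] star_weight(1) Q)
  then have w: "?w \<in> borel_measurable ?L"
    by (intro measurable_spherical_lebesgue continuous_on_sphere_measurable)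
  have gc: "continuous_on (sphere 0 1) ?g" by (rule continuous_on_support_powr[OF P])
  have g: "?g \<in> borel_measurable sphere_borel" by (rule continuous_on_sphere_measurable[OF gc])
  note \<alpha> = measurable_outer_normal[OF P]
  have \<alpha>': "?\<alpha> \<in> measurable (density ?L (\<lambda>u. ennreal (?w u))) sphere_borel"
    using \<alpha> by simp
  have w0: "0 \<le> ?w u" if "norm u = 1" for u
    using star_weight(2)[OF Q that, of q] by simp
  have Lp: "Lp_dual_curvature p q K Q = density ?D (\<lambda>v. ennreal (?g v))"
    unfolding Lp_dual_curvature_def dual_curvature_eq_distr[OF P Q] ..
  show "(\<integral>v. f v \<partial>Lp_dual_curvature p q K Q) = (\<integral>u. f (?\<alpha> u) * (?g (?\<alpha> u) * ?w u) \<partial>?L)"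
    if fc: "continuous_on (sphere 0 1) f"
  proof -
    have f: "f \<in> borel_measurable sphere_borel" by (rule continuous_on_sphere_measurable[OF fc])
    have gf: "(\<lambda>v. ?g v * f v) \<in> borel_measurable sphere_borel" using f g by (rule borel_measurable_times[rotated])
    have "(\<integral>v. f v \<partial>Lp_dual_curvature p q K Q) = (\<integral>v. ?g v *\<^sub>R f v \<partial>?D)"
      unfolding Lp by (rule integral_density) (use f g in auto)
    also have "\<dots> = (\<integral>v. ?g v * f v \<partial>?D)" by simp
    also have "\<dots> = (\<integral>u. ?g (?\<alpha> u) * f (?\<alpha> u) \<partial>density ?L (\<lambda>u. ennreal (?w u)))"
      by (rule integral_distr[OF \<alpha>' gf])
    also have "\<dots> = (\<integral>u. ?w u *\<^sub>R (?g (?\<alpha> u) * f (?\<alpha> u)) \<partial>?L)"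
      by (rule integral_density) (use measurable_compose[OF \<alpha> gf] w w0 in \<open>auto intro!: AE_I2\<close>)
    finally show ?thesis by (simp add: mult_ac)
  qed
  obtain B where B: "\<And>u. norm u = 1 \<Longrightarrow> \<bar>?w u\<bar> \<le> B" using continuous_on_sphere_bounded[OF wc] by blast
  obtain C where C: "\<And>u. norm u = 1 \<Longrightarrow> \<bar>?g u\<bar> \<le> C" using continuous_on_sphere_bounded[OF gc] by blast
  have "finite_measure (density ?L (\<lambda>u. ennreal (?w u)))"
    by (rule finite_measure_density_bounded[OF finite_measure_spherical_lebesgue w, of B])
      (use B in \<open>auto simp: abs_le_iff\<close>)
  then have "finite_measure ?D" using \<alpha>' by (rule finite_measure.finite_measure_distr)
  then have "finite_measure (density ?D (\<lambda>v. ennreal (?g v)))"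
    by (rule finite_measure_density_bounded[where B=C]) (use g C in \<open>auto simp: abs_le_iff\<close>)
  then show "sphere_measure (Lp_dual_curvature p q K Q)"
    unfolding sphere_measure_def Lp by simp
qed

section \<open>Weak convergence tested with varying functions\<close>

lemma sphere_measure_measurable:
  assumes "sphere_measure M" "continuous_on (sphere 0 1) f"
  shows "(f :: 'a::euclidean_space \<Rightarrow> real) \<in> borel_measurable M"
  using continuous_on_sphere_measurable[OF assms(2)] assms(1)
  by (auto simp: measurable_def sphere_measure_def)

lemma sphere_measure_integrable_bounded:
  fixes f :: "'a::euclidean_space \<Rightarrow> real"
  assumes M: "sphere_measure M" and f: "f \<in> borel_measurable M"
    and B: "\<And>u. norm u = 1 \<Longrightarrow> \<bar>f u\<bar> \<le> B"
  shows "integrable M f"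
proof -
  interpret finite_measure M using M by (simp add: sphere_measure_def)
  show ?thesis
    using M B by (intro integrable_const_bound[of _ B] f AE_I2) (auto simp: sphere_measure_def)
qed

lemma sphere_measure_integrable:
  fixes f :: "'a::euclidean_space \<Rightarrow> real"
  assumes M: "sphere_measure M" and f: "continuous_on (sphere 0 1) f"
  shows "integrable M f"
  using continuous_on_sphere_bounded[OF f] sphere_measure_integrable_bounded[OF M sphere_measure_measurable[OF M f]]
  by metis

lemma sphere_measure_integral_diff:
  fixes f g :: "'a::euclidean_space \<Rightarrow> real"
  assumes M: "sphere_measure M" and f: "continuous_on (sphere 0 1) f" and g: "continuous_on (sphere 0 1) g"
    and d: "\<And>u. norm u = 1 \<Longrightarrow> \<bar>f u - g u\<bar> \<le> d"
  shows "\<bar>(\<integral>u. f u \<partial>M) - (\<integral>u. g u \<partial>M)\<bar> \<le> d * (\<integral>u. 1 \<partial>M)"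
proof -
  note int = sphere_measure_integrable[OF M]
  have "(\<integral>u. f u \<partial>M) - (\<integral>u. g u \<partial>M) = (\<integral>u. f u - g u \<partial>M)"
    using int[OF f] int[OF g] by simp
  also have "\<bar>\<dots>\<bar> \<le> (\<integral>u. \<bar>f u - g u\<bar> \<partial>M)" by (rule integral_abs_bound)
  also have "\<dots> \<le> (\<integral>u. d * 1 \<partial>M)"
    by (rule integral_mono)
      (use M d in \<open>auto simp: sphere_measure_def intro!: int[of "\<lambda>_. d", simplified] int continuous_intros f g\<close>)
  also have "\<dots> = d * (\<integral>u. 1 \<partial>M)" by (rule integral_mult_right_zero)
  finally show ?thesis .
qed

text \<open>
  The masses of the \<open>M (k i)\<close> are bounded because they converge, so replacing \<open>f i\<close> by its uniform
  limit \<open>g\<close> changes the integrals by an amount that tends to zero.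
\<close>

lemma weak_convergence_uniform:
  fixes M :: "nat \<Rightarrow> 'a::euclidean_space measure" and f :: "nat \<Rightarrow> 'a \<Rightarrow> real"
  assumes M: "\<And>i. sphere_measure (M i)" and weak: "weakly_converges_sphere M N"
    and k: "filterlim k at_top sequentially"
    and f: "\<And>i. continuous_on (sphere 0 1) (f i)" and g: "continuous_on (sphere 0 1) g"
    and unif: "uniform_limit (sphere 0 1) f g sequentially"
  shows "(\<lambda>i. \<integral>u. f i u \<partial>M (k i)) \<longlonglongrightarrow> (\<integral>u. g u \<partial>N)"
proof -
  have conv: "(\<lambda>i. \<integral>u. f u \<partial>M (k i)) \<longlonglongrightarrow> (\<integral>u. f u \<partial>N)" if "continuous_on (sphere 0 1) f" for f :: "'a \<Rightarrow> real"
    using filterlim_compose[OF _ k, of "\<lambda>i. \<integral>u. f u \<partial>M i"] weak that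
    by (auto simp: weakly_converges_sphere_def)
  have "(\<lambda>i. \<integral>u. 1 \<partial>M (k i)) \<longlonglongrightarrow> (\<integral>u. 1 \<partial>N :: real)" by (rule conv) (rule continuous_on_const)
  then have "Bseq (\<lambda>i. \<integral>u. 1 \<partial>M (k i) :: real)"
    by (rule convergent_imp_Bseq[OF convergentI])
  then obtain B where B: "0 < B" "\<And>i. norm (\<integral>u. 1 \<partial>M (k i) :: real) \<le> B" by (elim BseqE) blast
  have "(\<lambda>i. (\<integral>u. f i u \<partial>M (k i)) - (\<integral>u. g u \<partial>M (k i))) \<longlonglongrightarrow> 0"
  proof (rule tendstoI)
    fix e :: real assume "0 < e"
    then have "\<forall>\<^sub>F i in sequentially. \<forall>u\<in>sphere 0 1. dist (f i u) (g u) < e / (2 * B)"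
      using unif B(1) by (intro uniform_limitD) auto
    then show "\<forall>\<^sub>F i in sequentially. dist ((\<integral>u. f i u \<partial>M (k i)) - (\<integral>u. g u \<partial>M (k i))) 0 < e"
    proof eventually_elim
      case (elim i)
      have "\<bar>(\<integral>u. f i u \<partial>M (k i)) - (\<integral>u. g u \<partial>M (k i))\<bar> \<le> e / (2 * B) * (\<integral>u. 1 \<partial>M (k i))"
        using elim by (intro sphere_measure_integral_diff M f g) (auto simp: dist_real_def less_imp_le)
      also have "\<dots> \<le> e / (2 * B) * B"
        using B(2)[of i] B(1) \<open>0 < e\<close> by (intro mult_left_mono) auto
      also have "\<dots> < e" using B(1) \<open>0 < e\<close> by simp
      finally show ?case by simp
    qed
  qed
  from tendsto_add[OF this conv[OF g]] show ?thesis by simp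
qed

lemma uniform_limit_parameter:
  fixes F :: "'a::metric_space \<times> 'b::metric_space \<Rightarrow> 'c::metric_space"
  assumes "compact S" "compact T" and F: "continuous_on (S \<times> T) F"
    and w: "\<And>i. w i \<in> T" "w \<longlonglongrightarrow> w0" and "w0 \<in> T"
  shows "uniform_limit S (\<lambda>i v. F (v, w i)) (\<lambda>v. F (v, w0)) sequentially"
proof (rule uniform_limitI)
  fix e :: real assume "0 < e"
  have "uniformly_continuous_on (S \<times> T) F"
    using assms by (intro compact_uniformly_continuous compact_Times)
  then obtain d where d: "0 < d"
    "\<And>x y. x \<in> S \<times> T \<Longrightarrow> y \<in> S \<times> T \<Longrightarrow> dist y x < d \<Longrightarrow> dist (F y) (F x) < e"
    using \<open>0 < e\<close> unfolding uniformly_continuous_on_def by metis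
  have "\<forall>\<^sub>F i in sequentially. dist (w i) w0 < d" using w(2) d(1) by (rule tendstoD)
  then show "\<forall>\<^sub>F i in sequentially. \<forall>v\<in>S. dist (F (v, w i)) (F (v, w0)) < e"
    by eventually_elim (use d(2) w(1) \<open>w0 \<in> T\<close> in \<open>auto simp: dist_Pair_Pair\<close>)
qed

text \<open>
  If no such \<open>c\<close> existed, the parameters \<open>w\<close> of the violations would accumulate at some \<open>w0\<close> by
  compactness of the sphere, and the integral of \<open>F (v, w0)\<close> against the limit measure would
  not be positive.
\<close>

lemma weak_convergence_uniformly_positive:
  fixes M :: "nat \<Rightarrow> 'a::euclidean_space measure" and F :: "'a \<times> 'a \<Rightarrow> real"
  assumes M: "\<And>i. sphere_measure (M i)" and weak: "weakly_converges_sphere M N"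
    and F: "continuous_on (sphere 0 1 \<times> sphere 0 1) F"
    and pos: "\<And>w. norm w = 1 \<Longrightarrow> 0 < (\<integral>v. F (v, w) \<partial>N)"
  obtains c n where "0 < c" "\<And>i w. n \<le> i \<Longrightarrow> norm w = 1 \<Longrightarrow> c \<le> (\<integral>v. F (v, w) \<partial>M i)"
proof -
  have "\<exists>m. \<forall>i\<ge>m. \<forall>w\<in>sphere 0 1. 1 / real (Suc m) \<le> (\<integral>v. F (v, w) \<partial>M i)"
  proof (rule ccontr)
    assume "\<not> ?thesis"
    then have "\<forall>m. \<exists>i w. m \<le> i \<and> w \<in> sphere 0 1 \<and> (\<integral>v. F (v, w) \<partial>M i) < 1 / real (Suc m)"
      by (metis not_less)
    then obtain k w where kw: "\<And>m. m \<le> k m" "\<And>m. w m \<in> sphere 0 1"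
      "\<And>m. (\<integral>v. F (v, w m) \<partial>M (k m)) < 1 / real (Suc m)" by metis
    obtain w0 s where s: "w0 \<in> sphere 0 1" "strict_mono s" "(w \<circ> s) \<longlonglongrightarrow> w0"
      using compact_sphere[of "0::'a" 1] kw(2) unfolding compact_eq_seq_compact_metric seq_compact_def by metis
    have "filterlim k at_top sequentially"
      using kw(1) by (intro filterlim_at_top_mono[OF filterlim_ident]) auto
    then have lim: "filterlim (k \<circ> s) at_top sequentially"
      unfolding comp_def by (rule filterlim_compose) (rule filterlim_subseq[OF s(2)])
    have cont: "continuous_on (sphere 0 1) (\<lambda>v. F (v, w))" if "w \<in> sphere 0 1" for w
      by (rule continuous_on_compose2[OF F]) (use that in \<open>auto intro!: continuous_intros\<close>)
    have "(\<lambda>m. \<integral>v. F (v, (w \<circ> s) m) \<partial>M ((k \<circ> s) m)) \<longlonglongrightarrow> (\<integral>v. F (v, w0) \<partial>N)"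
      by (rule weak_convergence_uniform[OF M weak lim cont cont uniform_limit_parameter[OF _ _ F]])
        (use s kw(2) in \<open>auto simp: comp_def\<close>)
    moreover have "(\<lambda>m. 1 / real (Suc (s m))) \<longlonglongrightarrow> 0"
      by (rule filterlim_compose[OF LIMSEQ_Suc[OF lim_1_over_n] filterlim_subseq[OF s(2)]])
    ultimately have "(\<integral>v. F (v, w0) \<partial>N) \<le> 0"
      by (rule LIMSEQ_le) (use kw(3) in \<open>auto intro!: exI[of _ 0] simp: less_imp_le\<close>)
    then show False using pos[of w0] s(1) by simp
  qed
  then obtain m where "\<forall>i\<ge>m. \<forall>w\<in>sphere 0 1. 1 / real (Suc m) \<le> (\<integral>v. F (v, w) \<partial>M i)" by blast
  then show ?thesis by (intro that[of "1 / real (Suc m)" m]) auto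
qed

lemma spherical_integral_pos:
  fixes f :: "'a::euclidean_space \<Rightarrow> real"
  assumes f: "integrable spherical_lebesgue f" and nonneg: "\<And>u. norm u = 1 \<Longrightarrow> 0 \<le> f u"
    and U: "open U" "u0 \<in> U" "norm u0 = 1" and pos: "\<And>u. norm u = 1 \<Longrightarrow> u \<in> U \<Longrightarrow> 0 < f u"
  shows "0 < (\<integral>u. f u \<partial>spherical_lebesgue)"
proof (rule ccontr)
  have AE: "AE u in spherical_lebesgue. 0 \<le> f u" using nonneg by (auto intro!: AE_I2)
  assume "\<not> ?thesis"
  then have "(\<integral>u. f u \<partial>spherical_lebesgue) = 0"
    using integral_nonneg_AE[OF AE] by simp
  then have "AE u in spherical_lebesgue. f u = 0"
    using integral_nonneg_eq_0_iff_AE[OF f AE] by simp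
  then have "AE u in spherical_lebesgue. u \<notin> U \<inter> sphere 0 1"
  proof eventually_elim
    case (elim u)
    then show ?case using pos[of u] by auto
  qed
  moreover have "U \<inter> sphere 0 1 \<in> sets sphere_borel"
    unfolding sphere_borel_def sets_restrict_space using U(1)
    by (subst Int_commute) (intro imageI borel_open)
  then have "U \<inter> sphere 0 1 \<in> sets spherical_lebesgue" using sets_sphere_borel_subset by blast
  ultimately have "emeasure spherical_lebesgue (U \<inter> sphere 0 1) = 0"
    by (subst (asm) AE_iff_measurable[of "U \<inter> sphere 0 1"]) auto
  then show False using spherical_lebesgue_open_pos[OF U] by simp
qed

lemma spherical_integral_continuous_pos:
  fixes f :: "'a::euclidean_space \<Rightarrow> real"
  assumes f: "continuous_on (sphere 0 1) f" and nonneg: "\<And>u. norm u = 1 \<Longrightarrow> 0 \<le> f u"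
    and u0: "norm u0 = 1" "0 < f u0"
  shows "0 < (\<integral>u. f u \<partial>spherical_lebesgue)"
proof -
  have "openin (top_of_set (sphere 0 1)) (sphere 0 1 \<inter> f -` {0<..})"
    using f by (intro continuous_openin_preimage_gen) auto
  then obtain U where U: "open U" "sphere 0 1 \<inter> f -` {0<..} = sphere 0 1 \<inter> U"
    unfolding openin_open by blast
  have iff: "0 < f u \<longleftrightarrow> u \<in> U" if "norm u = 1" for u
  proof -
    have "u \<in> sphere 0 1 \<inter> f -` {0<..} \<longleftrightarrow> u \<in> sphere 0 1 \<inter> U" unfolding U(2) ..
    then show ?thesis using that by simp
  qed
  have "u0 \<in> U" "\<And>u. norm u = 1 \<Longrightarrow> u \<in> U \<Longrightarrow> 0 < f u" using iff u0 by blast+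
  then show ?thesis
    using spherical_integral_pos[OF sphere_measure_integrable[OF sphere_measure_spherical_lebesgue f] nonneg U(1)] u0(1)
    by blast
qed

section \<open>Estimates for a single body and the comparison of two bodies\<close>

context
  fixes r R :: real and K Q :: "'a::euclidean_space set" and q :: real
  assumes P: "radial_support_pair r R (radial K) (support_fun K)" and Q: "Q \<in> star_bodies_o"
begin

abbreviation (input) "\<alpha> \<equiv> outer_normal (radial K) (support_fun K)"

lemma Lp_integrand_integrable:
  assumes f: "continuous_on (sphere 0 1) f"
  shows "integrable spherical_lebesgue (\<lambda>u. f (\<alpha> u) * (support_fun K (\<alpha> u) powr (- p)
         * (radial K u powr q * star_weight q Q u)))"
proof -
  have g: "continuous_on (sphere 0 1) (\<lambda>v. f v * support_fun K v powr (- p))"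
    by (intro continuous_on_mult f continuous_on_support_powr[OF P])
  have w: "continuous_on (sphere 0 1) (\<lambda>u. radial K u powr q * star_weight q Q u)"
    by (intro continuous_on_radial_weight[OF P] star_weight(1) Q)
  obtain B where B: "\<And>u. norm u = 1 \<Longrightarrow> \<bar>f u * support_fun K u powr (- p)\<bar> \<le> B"
    using continuous_on_sphere_bounded[OF g] by blast
  obtain C where C: "\<And>u. norm u = 1 \<Longrightarrow> \<bar>radial K u powr q * star_weight q Q u\<bar> \<le> C"
    using continuous_on_sphere_bounded[OF w] by blast
  have "(\<lambda>u. (f (\<alpha> u) * support_fun K (\<alpha> u) powr (- p)) * (radial K u powr q * star_weight q Q u))
      \<in> borel_measurable spherical_lebesgue"
    by (intro borel_measurable_times measurable_compose[OF measurable_outer_normal[OF P]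
          continuous_on_sphere_measurable[OF g]]
        measurable_spherical_lebesgue[OF continuous_on_sphere_measurable[OF w]])
  then have "integrable spherical_lebesgue (\<lambda>u. (f (\<alpha> u) * support_fun K (\<alpha> u) powr (- p)) *
     (radial K u powr q * star_weight q Q u))"
  proof (rule sphere_measure_integrable_bounded[OF sphere_measure_spherical_lebesgue])
    fix u :: 'a assume u: "norm u = 1"
    show "\<bar>(f (\<alpha> u) * support_fun K (\<alpha> u) powr (- p)) * (radial K u powr q * star_weight q Q u)\<bar> \<le> B * C"
      unfolding abs_mult[of "f (\<alpha> u) * _"]
      by (rule mult_mono) (use B[OF outer_normal(1)[OF P u]] C[OF u] in auto)
  qed
  then show ?thesis by (simp add: mult.assoc)
qed

text \<open>
  Put \<open>t = max 0 (\<alpha> u \<bullet> w)\<close>. Testing the point \<open>radial K w *\<^sub>R w\<close> of \<open>K\<close> against the normal \<open>\<alpha> u\<close>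
  shows that both \<open>support_fun K (\<alpha> u)\<close> and \<open>radial K u\<close> are at least \<open>radial K w * t\<close>. The exponent
  \<open>p - q\<close> is chosen so that the powers of \<open>t\<close> cancel.
\<close>

lemma hemisphere_moment_le:
  assumes w: "norm w = 1" and p: "0 \<le> p" and q: "q < 0"
  shows "(\<integral>v. max 0 (v \<bullet> w) powr (p - q) \<partial>Lp_dual_curvature p q K Q)
    \<le> radial K w powr (q - p) * (\<integral>u. star_weight q Q u \<partial>spherical_lebesgue)"
proof -
  note pos = radial_support_pair_pos[OF P]
  have f: "continuous_on (sphere 0 1) (\<lambda>v::'a. max 0 (v \<bullet> w) powr (p - q))"
    using p q by (intro continuous_on_powr' continuous_intros) auto
  have "(\<integral>u. max 0 (\<alpha> u \<bullet> w) powr (p - q) * (support_fun K (\<alpha> u) powr (- p)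
         * (radial K u powr q * star_weight q Q u)) \<partial>spherical_lebesgue)
    \<le> (\<integral>u. radial K w powr (q - p) * star_weight q Q u \<partial>spherical_lebesgue)"
  proof (rule integral_mono[OF Lp_integrand_integrable[OF f]])
    show "integrable spherical_lebesgue (\<lambda>u. radial K w powr (q - p) * star_weight q Q u)"
      by (intro sphere_measure_integrable[OF sphere_measure_spherical_lebesgue]
          continuous_on_mult continuous_on_const star_weight(1) Q)
    fix u :: 'a assume "u \<in> space spherical_lebesgue"
    then have u: "norm u = 1" by simp
    note \<alpha>u = outer_normal[OF P u]
    let ?t = "max 0 (\<alpha> u \<bullet> w)" and ?X = "radial K w"
    have W: "0 < star_weight q Q u" by (rule star_weight(2)[OF Q u])
    have "?t powr (p - q) * (support_fun K (\<alpha> u) powr (- p) * radial K u powr q) \<le> ?X powr (q - p)"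
    proof (cases "?t = 0")
      case False
      then have t: "0 < ?t" "\<alpha> u \<bullet> w = ?t" by (auto simp: max_def split: if_splits)
      have Xt: "0 < ?X * ?t" using t pos(1)[OF w] by simp
      have h: "?X * ?t \<le> support_fun K (\<alpha> u)"
        using radial_support_pairD(6)[OF P w \<alpha>u(1)] t by (simp add: inner_commute)
      have "radial K u * (u \<bullet> \<alpha> u) \<le> radial K u * 1"
        using pos(1)[OF u] inner_le_one[OF u \<alpha>u(1)] by (intro mult_left_mono) auto
      then have \<rho>: "?X * ?t \<le> radial K u" using h \<alpha>u(2) by simp
      have "?t powr (p - q) * (support_fun K (\<alpha> u) powr (- p) * radial K u powr q)
          \<le> ?t powr (p - q) * ((?X * ?t) powr (- p) * (?X * ?t) powr q)"
        using h \<rho> Xt p q by (intro mult_left_mono mult_mono powr_mono2') auto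
      also have "\<dots> = ?t powr (p - q) * (?X * ?t) powr (q - p)"
        by (simp add: powr_add[symmetric])
      also have "\<dots> = ?X powr (q - p) * (?t powr (p - q) * ?t powr (q - p))"
        using t pos(1)[OF w] by (simp add: powr_mult)
      also have "\<dots> = ?X powr (q - p)" using t by (simp add: powr_add[symmetric])
      finally show ?thesis .
    qed (simp)
    from mult_right_mono[OF this less_imp_le[OF W]]
    show "?t powr (p - q) * (support_fun K (\<alpha> u) powr (- p) * (radial K u powr q * star_weight q Q u))
       \<le> ?X powr (q - p) * star_weight q Q u" by (simp add: mult.assoc)
  qed
  then show ?thesis unfolding integral_Lp_dual_curvature[OF P Q f] by simp
qed

text \<open>
  Every outer normal at a direction \<open>u\<close> satisfies \<open>u \<bullet> \<alpha> u \<ge> r / R\<close>; so for \<open>u\<close> within \<open>r / R\<close>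
  of \<open>w\<close> the normal still lies in the open hemisphere about \<open>w\<close>.
\<close>

lemma hemisphere_moment_pos:
  assumes w: "norm w = 1" and s: "0 < s"
  shows "0 < (\<integral>v. max 0 (v \<bullet> w) powr s \<partial>Lp_dual_curvature p q K Q)"
proof -
  note pos = radial_support_pair_pos[OF P] and D = radial_support_pairD[OF P]
  have f: "continuous_on (sphere 0 1) (\<lambda>v::'a. max 0 (v \<bullet> w) powr s)"
    using s by (intro continuous_on_powr' continuous_intros) auto
  have R: "0 < R" using pos(1)[OF w] D(3)[OF w] by linarith
  show ?thesis unfolding integral_Lp_dual_curvature[OF P Q f]
  proof (rule spherical_integral_pos[OF Lp_integrand_integrable[OF f], where U = "ball w (r / R)" and ?u0.0 = w])
    show "w \<in> ball w (r / R)" using D(1) R by simp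
    fix u :: 'a assume u: "norm u = 1"
    note \<alpha>u = outer_normal[OF P u]
    note nn = star_weight(2)[OF Q u, of q] pos(1)[OF u] pos(2)[OF \<alpha>u(1)]
    show "0 \<le> max 0 (\<alpha> u \<bullet> w) powr s * (support_fun K (\<alpha> u) powr (- p)
         * (radial K u powr q * star_weight q Q u))" using nn by simp
    assume "u \<in> ball w (r / R)"
    then have "norm (w - u) < r / R" by (simp add: dist_norm)
    then have "norm (u - w) * R < r" using R by (simp add: norm_minus_commute field_simps)
    moreover have "r \<le> R * (u \<bullet> \<alpha> u)"
    proof -
      have "r \<le> radial K u * (u \<bullet> \<alpha> u)" using D(4)[OF \<alpha>u(1)] \<alpha>u(2) by simp
      moreover have "0 < u \<bullet> \<alpha> u" using \<alpha>u(2) nn by (metis zero_less_mult_pos)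
      ultimately show ?thesis using D(3)[OF u] by (smt (verit) mult_right_mono)
    qed
    moreover have "\<alpha> u \<bullet> (u - w) \<le> norm (u - w)" using norm_cauchy_schwarz[of "\<alpha> u" "u - w"] \<alpha>u(1) by simp
    then have "R * (\<alpha> u \<bullet> (u - w)) \<le> R * norm (u - w)" using R by simp
    ultimately have "0 < R * (\<alpha> u \<bullet> w)" by (simp add: inner_diff_right inner_commute algebra_simps)
    then have "0 < \<alpha> u \<bullet> w" using R by (simp add: zero_less_mult_iff)
    then show "0 < max 0 (\<alpha> u \<bullet> w) powr s * (support_fun K (\<alpha> u) powr (- p)
         * (radial K u powr q * star_weight q Q u))" using nn by simp
  qed (use w in auto)
qed

text \<open>
  The hyperplane with normal \<open>w\<close> gives \<open>radial K u \<le> support_fun K w / (u \<bullet> w)\<close> on the open hemisphere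
  about \<open>w\<close>, and \<open>support_fun K \<le> R\<close> everywhere.
\<close>

lemma total_mass_ge:
  assumes w: "norm w = 1" and p: "0 \<le> p" and q: "q < 0"
  shows "R powr (- p) * support_fun K w powr q *
      (\<integral>u. max 0 (u \<bullet> w) powr (- q) * star_weight q Q u \<partial>spherical_lebesgue)
    \<le> (\<integral>v. 1 \<partial>Lp_dual_curvature p q K Q)"
proof -
  note pos = radial_support_pair_pos[OF P] and D = radial_support_pairD[OF P]
  let ?c = "R powr (- p) * support_fun K w powr q"
  have f: "continuous_on (sphere 0 1) (\<lambda>u::'a. max 0 (u \<bullet> w) powr (- q))"
    using q by (intro continuous_on_powr' continuous_intros) auto
  have "(\<integral>u. ?c * (max 0 (u \<bullet> w) powr (- q) * star_weight q Q u) \<partial>spherical_lebesgue)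
    \<le> (\<integral>u. 1 * (support_fun K (\<alpha> u) powr (- p) * (radial K u powr q * star_weight q Q u)) \<partial>spherical_lebesgue)"
  proof (rule integral_mono[OF _ Lp_integrand_integrable[OF continuous_on_const]])
    show "integrable spherical_lebesgue (\<lambda>u. ?c * (max 0 (u \<bullet> w) powr (- q) * star_weight q Q u))"
      by (intro sphere_measure_integrable[OF sphere_measure_spherical_lebesgue]
          continuous_on_mult continuous_on_const star_weight(1) Q f)
    fix u :: 'a assume "u \<in> space spherical_lebesgue"
    then have u: "norm u = 1" by simp
    note \<alpha>u = outer_normal[OF P u]
    have W: "0 < star_weight q Q u" by (rule star_weight(2)[OF Q u])
    have "R powr (- p) \<le> support_fun K (\<alpha> u) powr (- p)"
      using D(5)[OF \<alpha>u(1)] pos(2)[OF \<alpha>u(1)] p by (intro powr_mono2') auto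
    moreover have "support_fun K w powr q * max 0 (u \<bullet> w) powr (- q) \<le> radial K u powr q"
    proof (cases "u \<bullet> w > 0")
      case True
      have "radial K u \<le> support_fun K w / (u \<bullet> w)"
        using D(6)[OF u w] True by (simp add: field_simps)
      then have "(support_fun K w / (u \<bullet> w)) powr q \<le> radial K u powr q"
        using pos(1)[OF u] q by (intro powr_mono2') auto
      then show ?thesis using True pos(2)[OF w] by (simp add: powr_divide powr_minus divide_inverse[symmetric])
    qed (use q in simp)
    ultimately have "R powr (- p) * (support_fun K w powr q * max 0 (u \<bullet> w) powr (- q))
        \<le> support_fun K (\<alpha> u) powr (- p) * radial K u powr q"
      by (intro mult_mono) auto
    from mult_right_mono[OF this less_imp_le[OF W]]
    show "?c * (max 0 (u \<bullet> w) powr (- q) * star_weight q Q u)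
      \<le> 1 * (support_fun K (\<alpha> u) powr (- p) * (radial K u powr q * star_weight q Q u))"
      by (simp add: mult_ac)
  qed
  then show ?thesis unfolding integral_Lp_dual_curvature[OF P Q continuous_on_const] by simp
qed

end

text \<open>
  With \<open>\<alpha>\<close> and \<open>\<beta>\<close> the normals of \<open>K\<close> and \<open>L\<close> and \<open>t u = radial K u / radial L u - 1\<close>, the
  pointwise inequalities are
  \<open>support_fun K / support_fun L - 1 \<ge> t u\<close> at \<open>\<beta> u\<close> and \<open>\<le> t u\<close> at \<open>\<alpha> u\<close>.
  In the second one, the factor
  \<open>(support_fun K / support_fun L) powr (- p)\<close> remains; it is at most \<open>1\<close> when the ratio is at least \<open>1\<close>
  and at least \<open>1\<close> otherwise, so dropping it increases the product in either case.
\<close>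

lemma comparison_inequality:
  fixes K L Q :: "'a::euclidean_space set"
  assumes P: "radial_support_pair r R (radial K) (support_fun K)"
    and P0: "radial_support_pair r0 R0 (radial L) (support_fun L)"
    and Q: "Q \<in> star_bodies_o" and p: "0 \<le> p"
  defines "f \<equiv> \<lambda>v. (support_fun K v / support_fun L v - 1) * support_fun L v powr p"
  shows "(\<integral>u. (radial K u / radial L u - 1) * (radial L u powr q - radial K u powr q) * star_weight q Q u
      \<partial>spherical_lebesgue)
    \<le> (\<integral>v. f v \<partial>Lp_dual_curvature p q L Q) - (\<integral>v. f v \<partial>Lp_dual_curvature p q K Q)"
proof -
  let ?\<alpha> = "outer_normal (radial K) (support_fun K)" and ?\<beta> = "outer_normal (radial L) (support_fun L)"
  let ?W = "star_weight q Q" and ?\<sigma> = "spherical_lebesgue :: 'a measure"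
  note pos = radial_support_pair_pos[OF P] and pos0 = radial_support_pair_pos[OF P0]
  note D = radial_support_pairD[OF P] and D0 = radial_support_pairD[OF P0]
  have ne: "\<forall>v\<in>sphere 0 1. support_fun L v \<noteq> 0" "\<forall>v\<in>sphere 0 1. radial L v \<noteq> 0"
    using pos0 by (metis less_irrefl mem_sphere_0)+
  have f: "continuous_on (sphere 0 1) f"
    unfolding f_def
    by (intro continuous_on_mult continuous_on_diff continuous_on_divide continuous_on_const
        continuous_on_support_powr[OF P0] radial_support_pair_continuous(2)[OF P]
        radial_support_pair_continuous(2)[OF P0] ne)
  define t where "t u = radial K u / radial L u - 1" for u
  have t: "continuous_on (sphere 0 1) t"
    unfolding t_def
    by (intro continuous_on_diff continuous_on_divide continuous_on_const
        radial_support_pair_continuous(1)[OF P] radial_support_pair_continuous(1)[OF P0] ne)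
  have intL: "integrable ?\<sigma> (\<lambda>u. t u * (radial L u powr q * ?W u))"
    and intK: "integrable ?\<sigma> (\<lambda>u. t u * (radial K u powr q * ?W u))"
    by (intro sphere_measure_integrable[OF sphere_measure_spherical_lebesgue] continuous_on_mult t
        continuous_on_radial_weight[OF P] continuous_on_radial_weight[OF P0] star_weight(1)[OF Q])+
  have "(\<integral>u. t u * (radial L u powr q * ?W u) \<partial>?\<sigma>)
     \<le> (\<integral>u. f (?\<beta> u) * (support_fun L (?\<beta> u) powr (- p) * (radial L u powr q * ?W u)) \<partial>?\<sigma>)"
  proof (rule integral_mono[OF intL Lp_integrand_integrable[OF P0 Q f]])
    fix u :: 'a assume "u \<in> space ?\<sigma>"
    then have u: "norm u = 1" by simp
    note b = outer_normal[OF P0 u]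
    have hL: "0 < support_fun L (?\<beta> u)" by (rule pos0(2)[OF b(1)])
    then have c: "0 < u \<bullet> ?\<beta> u" using b(2) pos0(1)[OF u] by (metis zero_less_mult_pos)
    have "radial K u / radial L u = radial K u * (u \<bullet> ?\<beta> u) / support_fun L (?\<beta> u)"
      unfolding b(2)[symmetric] using c by simp
    also have "\<dots> \<le> support_fun K (?\<beta> u) / support_fun L (?\<beta> u)"
      using D(6)[OF u b(1)] hL by (intro divide_right_mono) auto
    finally have "t u \<le> f (?\<beta> u) * support_fun L (?\<beta> u) powr (- p)"
      unfolding f_def t_def using hL by (simp add: powr_minus mult.assoc)
    then have "t u * (radial L u powr q * ?W u)
      \<le> f (?\<beta> u) * support_fun L (?\<beta> u) powr (- p) * (radial L u powr q * ?W u)"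
      using star_weight(2)[OF Q u, of q] by (intro mult_right_mono) auto
    then show "t u * (radial L u powr q * ?W u)
      \<le> f (?\<beta> u) * (support_fun L (?\<beta> u) powr (- p) * (radial L u powr q * ?W u))"
      by (simp add: mult.assoc)
  qed
  moreover have "(\<integral>u. f (?\<alpha> u) * (support_fun K (?\<alpha> u) powr (- p) * (radial K u powr q * ?W u)) \<partial>?\<sigma>)
     \<le> (\<integral>u. t u * (radial K u powr q * ?W u) \<partial>?\<sigma>)"
  proof (rule integral_mono[OF Lp_integrand_integrable[OF P Q f] intK])
    fix u :: 'a assume "u \<in> space ?\<sigma>"
    then have u: "norm u = 1" by simp
    note a = outer_normal[OF P u]
    let ?h = "support_fun K (?\<alpha> u)" and ?l = "support_fun L (?\<alpha> u)"
    have h: "0 < ?h" "0 < ?l" by (rule pos(2)[OF a(1)], rule pos0(2)[OF a(1)])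
    then have c: "0 < u \<bullet> ?\<alpha> u" using a(2) pos(1)[OF u] by (metis zero_less_mult_pos)
    have "f (?\<alpha> u) * ?h powr (- p) = (?h / ?l - 1) * (?h / ?l) powr (- p)"
      unfolding f_def using h by (simp add: powr_divide powr_minus divide_simps)
    also have "\<dots> \<le> (?h / ?l - 1) * 1"
    proof (cases "?h / ?l \<ge> 1")
      case True
      then have "(?h / ?l) powr (- p) \<le> 1 powr (- p)" using p by (intro powr_mono2') auto
      then show ?thesis using True by (intro mult_left_mono) auto
    next
      case False
      then have "1 powr (- p) \<le> (?h / ?l) powr (- p)" using p h by (intro powr_mono2') auto
      then show ?thesis using False by (intro mult_left_mono_neg) auto
    qed
    also have "?h / ?l = radial K u * (u \<bullet> ?\<alpha> u) / ?l" using a(2) by simp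
    also have "\<dots> \<le> radial K u * (u \<bullet> ?\<alpha> u) / (radial L u * (u \<bullet> ?\<alpha> u))"
      using D0(6)[OF u a(1)] h pos(1)[OF u] pos0(1)[OF u] c by (intro divide_left_mono) auto
    also have "\<dots> = radial K u / radial L u" using c by simp
    finally have "f (?\<alpha> u) * ?h powr (- p) \<le> t u" unfolding t_def by simp
    then have "f (?\<alpha> u) * ?h powr (- p) * (radial K u powr q * ?W u) \<le> t u * (radial K u powr q * ?W u)"
      using star_weight(2)[OF Q u, of q] by (intro mult_right_mono) auto
    then show "f (?\<alpha> u) * (?h powr (- p) * (radial K u powr q * ?W u)) \<le> t u * (radial K u powr q * ?W u)"
      by (simp add: mult.assoc)
  qed
  moreover have "(\<integral>u. t u * (radial L u powr q - radial K u powr q) * ?W u \<partial>?\<sigma>) =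
     (\<integral>u. t u * (radial L u powr q * ?W u) \<partial>?\<sigma>) - (\<integral>u. t u * (radial K u powr q * ?W u) \<partial>?\<sigma>)"
    unfolding Bochner_Integration.integral_diff[OF intL intK, symmetric]
    by (simp add: algebra_simps)
  ultimately show ?thesis
    unfolding integral_Lp_dual_curvature[OF P Q f] integral_Lp_dual_curvature[OF P0 Q f] t_def by simp
qed

section \<open>Convergence of the bodies\<close>

context
  fixes p q :: real and Q :: "'a::euclidean_space set" and K :: "nat \<Rightarrow> 'a set"
  assumes q: "q < 0" and p: "0 \<le> p" and Q: "Q \<in> star_bodies_o"
    and K: "\<And>i. K i \<in> convex_bodies_o"
    and weak: "weakly_converges_sphere (\<lambda>i. Lp_dual_curvature p q (K (Suc i)) Q)
           (Lp_dual_curvature p q (K 0) Q)"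
begin

lemma sphere_measure_of_body: "sphere_measure (Lp_dual_curvature p q (K i) Q)"
  using convex_body_radial_support_pair[OF K] sphere_measure_Lp_dual_curvature[OF _ Q] by metis

text \<open>
  The \<open>(p - q)\<close>-th hemisphere moments of the measures are eventually bounded below by some \<open>c > 0\<close>,
  uniformly in the hemisphere, while a value \<open>radial (K (Suc i)) w > R\<close> makes the moment about \<open>w\<close>
  at most a constant times \<open>R powr (q - p)\<close>.
\<close>

lemma radial_eventually_bounded:
  obtains R n where "0 < R" "\<And>i u. n \<le> i \<Longrightarrow> norm u = 1 \<Longrightarrow> radial (K (Suc i)) u \<le> R"
proof -
  let ?F = "\<lambda>(v::'a, w). max 0 (v \<bullet> w) powr (p - q)"
  let ?C = "\<integral>u. star_weight q Q u \<partial>spherical_lebesgue"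
  have F: "continuous_on (sphere 0 1 \<times> sphere 0 1) ?F"
    unfolding case_prod_unfold using p q by (intro continuous_on_powr' continuous_intros) auto
  obtain r0 R0 where P0: "radial_support_pair r0 R0 (radial (K 0)) (support_fun (K 0))"
    using convex_body_radial_support_pair[OF K] by blast
  have "0 < (\<integral>v. ?F (v, w) \<partial>Lp_dual_curvature p q (K 0) Q)" if "norm w = 1" for w
    using hemisphere_moment_pos[OF P0 Q that, of "p - q" p q] p q by simp
  from weak_convergence_uniformly_positive[OF sphere_measure_of_body weak F this]
  obtain c n where c: "0 < c"
    "\<And>i w. n \<le> i \<Longrightarrow> norm w = 1 \<Longrightarrow> c \<le> (\<integral>v. ?F (v, w) \<partial>Lp_dual_curvature p q (K (Suc i)) Q)"
    by blast
  obtain u0 :: 'a where "norm u0 = 1" using norm_Basis SOME_Basis by blast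
  then have C: "0 < ?C"
    using star_weight[OF Q, where q=q]
    by (intro spherical_integral_continuous_pos[where ?u0.0=u0]) (auto simp: less_imp_le)
  \<comment> \<open>chosen such that the upper bound for the moment, \<open>R powr (q - p) * ?C\<close>, equals \<open>c / 2\<close>\<close>
  define R where "R = (c / (2 * ?C)) powr (1 / (q - p))"
  have R: "0 < R" "R powr (q - p) = c / (2 * ?C)" using c(1) C p q by (auto simp: R_def powr_powr)
  have "radial (K (Suc i)) w \<le> R" if i: "n \<le> i" and w: "norm w = 1" for i w
  proof (rule ccontr)
    assume "\<not> ?thesis"
    then have R': "R \<le> radial (K (Suc i)) w" by simp
    obtain r1 R1 where P1: "radial_support_pair r1 R1 (radial (K (Suc i))) (support_fun (K (Suc i)))"
      using convex_body_radial_support_pair[OF K] by blast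
    have "c \<le> radial (K (Suc i)) w powr (q - p) * ?C"
      using hemisphere_moment_le[OF P1 Q w p q] c(2)[OF i w] by simp
    also have "\<dots> \<le> R powr (q - p) * ?C"
      using R(1) R' p q C by (intro mult_right_mono powr_mono2') auto
    also have "\<dots> = c / 2" using R(2) C by simp
    finally show False using c(1) by simp
  qed
  then show ?thesis using that R(1) by blast
qed

text \<open>
  By the convergence of the total masses and \<open>total_mass_ge\<close>, the values
  \<open>support_fun (K (Suc i)) w powr q\<close> are bounded, and \<open>q < 0\<close>.
\<close>

lemma eventually_uniform_radial_support_pair:
  "\<exists>r R n. \<forall>i\<ge>n. radial_support_pair r R (radial (K (Suc i))) (support_fun (K (Suc i)))"
proof -
  obtain R n where R: "0 < R" "\<And>i u. n \<le> i \<Longrightarrow> norm u = 1 \<Longrightarrow> radial (K (Suc i)) u \<le> R"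
    using radial_eventually_bounded by blast
  let ?F = "\<lambda>(u::'a, w). max 0 (u \<bullet> w) powr (- q) * star_weight q Q u"
  note sw = star_weight[OF Q, where q=q]
  have cont: "continuous_on (sphere 0 1 \<times> sphere 0 1) (\<lambda>z. star_weight q Q (fst z))"
    by (rule continuous_on_compose2[OF sw(1)]) (auto intro!: continuous_intros)
  have F: "continuous_on (sphere 0 1 \<times> sphere 0 1) ?F"
    unfolding case_prod_unfold
    by (intro continuous_on_mult cont) (use q in \<open>intro continuous_on_powr' continuous_intros; auto\<close>)
  have Fpos: "0 < (\<integral>v. ?F (v, w) \<partial>spherical_lebesgue)" if w: "norm w = 1" for w
  proof -
    have Fw: "continuous_on (sphere 0 1) (\<lambda>v. ?F (v, w))"
      by (rule continuous_on_compose2[OF F]) (use w in \<open>auto intro!: continuous_intros\<close>)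
    show ?thesis
    proof (rule spherical_integral_continuous_pos[OF Fw _ w])
      show "0 \<le> ?F (v, w)" if "norm v = 1" for v using sw(2)[OF that] by simp
      show "0 < ?F (w, w)" using sw(2)[OF w] w by (simp add: norm_eq_1)
    qed
  qed
  \<comment> \<open>a constant sequence of measures: only the uniformity in \<open>w\<close> is wanted here\<close>
  have "weakly_converges_sphere (\<lambda>i. spherical_lebesgue) (spherical_lebesgue :: 'a measure)"
    by (simp add: weakly_converges_sphere_def)
  from weak_convergence_uniformly_positive[OF sphere_measure_spherical_lebesgue this F Fpos]
  obtain c m where cm: "0 < c"
    "\<And>i w. (m::nat) \<le> i \<Longrightarrow> norm w = 1 \<Longrightarrow> c \<le> (\<integral>v. ?F (v, w) \<partial>spherical_lebesgue)"
    by blast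
  note c = cm(1) cm(2)[OF order_refl]
  have "(\<lambda>i. \<integral>v. 1 \<partial>Lp_dual_curvature p q (K (Suc i)) Q :: real)
     \<longlonglongrightarrow> (\<integral>v. 1 \<partial>Lp_dual_curvature p q (K 0) Q)"
    using weak continuous_on_const unfolding weakly_converges_sphere_def by blast
  then have "Bseq (\<lambda>i. \<integral>v. 1 \<partial>Lp_dual_curvature p q (K (Suc i)) Q :: real)"
    by (rule convergent_imp_Bseq[OF convergentI])
  then obtain B where B: "0 < B" "\<And>i. norm (\<integral>v. 1 \<partial>Lp_dual_curvature p q (K (Suc i)) Q :: real) \<le> B"
    by (elim BseqE) blast
  \<comment> \<open>chosen such that the lower bound for the total mass, \<open>R powr (- p) * r powr q * c\<close>, equals \<open>2 * B\<close>\<close>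
  define r where "r = (2 * B / (R powr (- p) * c)) powr (1 / q)"
  have r: "0 < r" "r powr q = 2 * B / (R powr (- p) * c)"
    using B(1) R(1) c(1) q by (auto simp: r_def powr_powr)
  show ?thesis
  proof (rule exI[of _ r], rule exI[of _ R], rule exI[of _ n], intro allI impI)
    fix i assume i: "n \<le> i"
    let ?L = "K (Suc i)"
    obtain r1 R1 where P': "radial_support_pair r1 R1 (radial ?L) (support_fun ?L)"
      using convex_body_radial_support_pair[OF K] by blast
    have P1: "radial_support_pair r1 R (radial ?L) (support_fun ?L)"
      by (rule radial_support_pair_bounds[OF P' radial_support_pairD(1)[OF P']
            radial_support_pairD(4)[OF P'] R(2)[OF i]])
    have "r \<le> support_fun ?L w" if w: "norm w = 1" for w
    proof (rule ccontr)
      assume "\<not> ?thesis"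
      then have h: "0 < support_fun ?L w" "support_fun ?L w \<le> r"
        using radial_support_pair_pos(2)[OF P1 w] by auto
      have "2 * B = R powr (- p) * r powr q * c" using r(2) R(1) c(1) by simp
      also have "\<dots> \<le> R powr (- p) * support_fun ?L w powr q * (\<integral>v. ?F (v, w) \<partial>spherical_lebesgue)"
        using h q c(1) by (intro mult_mono c(2) w mult_left_mono powr_mono2') auto
      also have "\<dots> \<le> B" using total_mass_ge[OF P1 Q w p q] B(2)[of i] by simp
      finally show False using B(1) by simp
    qed
    then show "radial_support_pair r R (radial ?L) (support_fun ?L)"
      by (rule radial_support_pair_bounds[OF P1 r(1) _ R(2)[OF i]])
  qed
qed

text \<open>
  Along the subsequence both sides of \<open>comparison_inequality\<close> converge: the right-hand side to zero,
  the left-hand side to the integral of a continuous nonnegative function, which therefore vanishes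
  identically.
\<close>

lemma limit_radial_eq:
  assumes k: "filterlim k at_top sequentially"
    and P: "\<And>i. radial_support_pair r R (radial (K (Suc (k i)))) (support_fun (K (Suc (k i))))"
    and h: "continuous_on (sphere 0 1) h"
      "uniform_limit (sphere 0 1) (\<lambda>i. support_fun (K (Suc (k i)))) h sequentially"
    and \<rho>: "continuous_on (sphere 0 1) \<rho>"
      "\<And>u. norm u = 1 \<Longrightarrow> (\<lambda>i. radial (K (Suc (k i))) u) \<longlonglongrightarrow> \<rho> u"
    and u0: "norm u0 = 1"
  shows "\<rho> u0 = radial (K 0) u0"
proof -
  let ?h0 = "support_fun (K 0)" and ?\<rho>0 = "radial (K 0)" and ?W = "star_weight q Q"
  let ?\<sigma> = "spherical_lebesgue :: 'a measure"
  note sw = star_weight[OF Q, where q=q]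
  obtain r0 R0 where P0: "radial_support_pair r0 R0 ?\<rho>0 ?h0"
    using convex_body_radial_support_pair[OF K] by blast
  note pos0 = radial_support_pair_pos[OF P0]
  have r: "0 < r" by (rule radial_support_pairD(1)[OF P])
  have \<rho>r: "r \<le> \<rho> u" if "norm u = 1" for u
    using \<rho>(2)[OF that] radial_support_pairD(2)[OF P that] by (intro LIMSEQ_le_const) auto
  have ne: "\<forall>v\<in>sphere 0 1. ?h0 v \<noteq> 0" "\<forall>v\<in>sphere 0 1. ?\<rho>0 v \<noteq> 0" "\<forall>v\<in>sphere 0 1. \<rho> v \<noteq> 0"
    using pos0 \<rho>r r by (metis less_irrefl mem_sphere_0, metis less_irrefl mem_sphere_0, metis not_less mem_sphere_0)
  \<comment> \<open>\<open>f i\<close> below is the test function of \<open>comparison_inequality\<close>, in which \<open>support_fun (K (Suc (k i)))\<close>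
    enters affinely with the fixed factor \<open>c\<close>\<close>
  define c where "c v = ?h0 v powr p / ?h0 v" for v
  have c: "continuous_on (sphere 0 1) c"
    unfolding c_def by (intro continuous_on_divide continuous_on_support_powr[OF P0]
      radial_support_pair_continuous(2)[OF P0] ne)
  obtain C where C: "\<And>u. norm u = 1 \<Longrightarrow> \<bar>c u\<bar> \<le> C" using continuous_on_sphere_bounded[OF c] by blast
  define f where "f i v = (support_fun (K (Suc (k i))) v - ?h0 v) * c v" for i v
  define g where "g v = (h v - ?h0 v) * c v" for v
  have f: "continuous_on (sphere 0 1) (f i)" for i
    unfolding f_def by (intro continuous_on_mult continuous_on_diff c
      radial_support_pair_continuous(2)[OF P] radial_support_pair_continuous(2)[OF P0])
  have g: "continuous_on (sphere 0 1) g"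
    unfolding g_def by (intro continuous_on_mult continuous_on_diff c h(1) radial_support_pair_continuous(2)[OF P0])
  have fg: "uniform_limit (sphere 0 1) f g sequentially"
  proof (rule uniform_limitI)
    fix e :: real assume e: "0 < e"
    have "0 < e / (\<bar>C\<bar> + 1)" using e by simp
    from uniform_limitD[OF h(2) this]
    show "\<forall>\<^sub>F i in sequentially. \<forall>v\<in>sphere 0 1. dist (f i v) (g v) < e"
    proof eventually_elim
      case (elim i)
      show ?case
      proof
        fix v :: 'a assume v: "v \<in> sphere 0 1"
        have "dist (f i v) (g v) = \<bar>support_fun (K (Suc (k i))) v - h v\<bar> * \<bar>c v\<bar>"
          unfolding f_def g_def dist_real_def abs_mult[symmetric] by (simp add: algebra_simps)
        also have "\<dots> \<le> \<bar>support_fun (K (Suc (k i))) v - h v\<bar> * (\<bar>C\<bar> + 1)"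
          using C[of v] v by (intro mult_left_mono) auto
        also have "\<dots> < e / (\<bar>C\<bar> + 1) * (\<bar>C\<bar> + 1)"
          using elim v by (intro mult_strict_right_mono) (auto simp: dist_real_def)
        finally show "dist (f i v) (g v) < e" by (simp add: add_nonneg_pos[THEN less_imp_neq, symmetric])
      qed
    qed
  qed
  have "(\<lambda>i. \<integral>v. f i v \<partial>Lp_dual_curvature p q (K 0) Q) \<longlonglongrightarrow> (\<integral>v. g v \<partial>Lp_dual_curvature p q (K 0) Q)"
    by (rule weak_convergence_uniform[OF sphere_measure_of_body _ filterlim_ident f g fg])
      (simp add: weakly_converges_sphere_def)
  moreover have "(\<lambda>i. \<integral>v. f i v \<partial>Lp_dual_curvature p q (K (Suc (k i))) Q)
      \<longlonglongrightarrow> (\<integral>v. g v \<partial>Lp_dual_curvature p q (K 0) Q)"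
    by (rule weak_convergence_uniform[OF sphere_measure_of_body weak k f g fg])
  ultimately have rhs: "(\<lambda>i. (\<integral>v. f i v \<partial>Lp_dual_curvature p q (K 0) Q)
      - (\<integral>v. f i v \<partial>Lp_dual_curvature p q (K (Suc (k i))) Q)) \<longlonglongrightarrow> 0"
    using tendsto_diff by fastforce
  define G where "G \<tau> u = (\<tau> u / ?\<rho>0 u - 1) * (?\<rho>0 u powr q - \<tau> u powr q) * ?W u" for \<tau> u
  have le: "(\<integral>u. G (radial (K (Suc (k i)))) u \<partial>?\<sigma>) \<le> (\<integral>v. f i v \<partial>Lp_dual_curvature p q (K 0) Q)
      - (\<integral>v. f i v \<partial>Lp_dual_curvature p q (K (Suc (k i))) Q)" for i
  proof -
    let ?g = "support_fun (K (Suc (k i)))"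
    have "(\<integral>v. f i v \<partial>Lp_dual_curvature p q L Q) = (\<integral>v. (?g v / ?h0 v - 1) * ?h0 v powr p \<partial>Lp_dual_curvature p q L Q)"
      if "sphere_measure (Lp_dual_curvature p q L Q)" for L
    proof (rule Bochner_Integration.integral_cong[OF refl])
      fix v assume "v \<in> space (Lp_dual_curvature p q L Q)"
      then have "norm v = 1" using that by (auto simp: sphere_measure_def)
      then show "f i v = (?g v / ?h0 v - 1) * ?h0 v powr p"
        using pos0(2)[of v] by (simp add: f_def c_def field_simps)
    qed
    then show ?thesis
      unfolding G_def using comparison_inequality[OF P P0 Q p, of i q] sphere_measure_of_body by simp
  qed
  have Gcont: "continuous_on (sphere 0 1) (G \<tau>)"
    if "continuous_on (sphere 0 1) \<tau>" "\<forall>u\<in>sphere 0 1. \<tau> u \<noteq> 0" for \<tau>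
    unfolding G_def
    by (intro continuous_on_mult continuous_on_diff continuous_on_divide continuous_on_powr sw(1)
        continuous_on_const that radial_support_pair_continuous(1)[OF P0] ne)
  have G0: "0 \<le> G \<rho> u" if u: "norm u = 1" for u
  proof -
    have \<rho>u: "0 < \<rho> u" using \<rho>r[OF u] r by simp
    have "0 \<le> (\<rho> u / ?\<rho>0 u - 1) * (?\<rho>0 u powr q - \<rho> u powr q)"
    proof (cases "?\<rho>0 u \<le> \<rho> u")
      case True
      then show ?thesis using pos0(1)[OF u] q powr_mono2'[of q "?\<rho>0 u" "\<rho> u"]
        by (intro mult_nonneg_nonneg) auto
    next
      case False
      then show ?thesis using pos0(1)[OF u] \<rho>u q powr_mono2'[of q "\<rho> u" "?\<rho>0 u"]
        by (intro mult_nonpos_nonpos) auto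
    qed
    then show ?thesis unfolding G_def using sw(2)[OF u] by simp
  qed
  obtain B where B: "\<And>u. norm u = 1 \<Longrightarrow> \<bar>?W u\<bar> \<le> B" using continuous_on_sphere_bounded[OF sw(1)] by blast
  have "(\<lambda>i. \<integral>u. G (radial (K (Suc (k i)))) u \<partial>?\<sigma>) \<longlonglongrightarrow> (\<integral>u. G \<rho> u \<partial>?\<sigma>)"
  proof (rule integral_dominated_convergence)
    show "G \<rho> \<in> borel_measurable ?\<sigma>"
      by (rule sphere_measure_measurable[OF sphere_measure_spherical_lebesgue Gcont[OF \<rho>(1) ne(3)]])
    have nei: "\<forall>u\<in>sphere 0 1. radial (K (Suc (k i))) u \<noteq> 0" for i
      using radial_support_pair_pos(1)[OF P] by (metis less_irrefl mem_sphere_0)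
    show "G (radial (K (Suc (k i)))) \<in> borel_measurable ?\<sigma>" for i
      by (rule sphere_measure_measurable[OF sphere_measure_spherical_lebesgue
            Gcont[OF radial_support_pair_continuous(1)[OF P] nei]])
    have "(\<lambda>i. G (radial (K (Suc (k i)))) u) \<longlonglongrightarrow> G \<rho> u" if u: "norm u = 1" for u
      unfolding G_def using pos0(1)[OF u] \<rho>r[OF u] r
      by (intro tendsto_intros \<rho>(2) u) auto
    then show "AE u in ?\<sigma>. (\<lambda>i. G (radial (K (Suc (k i)))) u) \<longlonglongrightarrow> G \<rho> u"
      by (intro AE_I2) simp
    let ?b = "(R / r0 + 1) * (r0 powr q + r powr q) * B"
    have "norm (G (radial (K (Suc (k i)))) u) \<le> ?b" if u: "norm u = 1" for i u
    proof -
      let ?\<tau> = "radial (K (Suc (k i))) u"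
      note \<tau> = radial_support_pairD(2,3)[OF P u, of i]
      note \<rho>0 = radial_support_pairD(1)[OF P0] radial_support_pairD(2)[OF P0 u]
      have "0 \<le> ?\<tau> / ?\<rho>0 u" "?\<tau> / ?\<rho>0 u \<le> R / r0"
        using \<tau> \<rho>0 r by (auto intro!: divide_nonneg_nonneg frac_le)
      then have 1: "\<bar>?\<tau> / ?\<rho>0 u - 1\<bar> \<le> R / r0 + 1" by linarith
      have "?\<rho>0 u powr q \<le> r0 powr q" "?\<tau> powr q \<le> r powr q"
        using \<tau> \<rho>0 r q by (auto intro!: powr_mono2')
      then have 2: "\<bar>?\<rho>0 u powr q - ?\<tau> powr q\<bar> \<le> r0 powr q + r powr q"
        using powr_ge_zero[of "?\<rho>0 u" q] powr_ge_zero[of ?\<tau> q] by linarith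
      have "0 \<le> R / r0 + 1" using 1 by linarith
      then show ?thesis
        unfolding G_def real_norm_def abs_mult by (intro mult_mono 1 2 B u mult_nonneg_nonneg) auto
    qed
    then show "AE u in ?\<sigma>. norm (G (radial (K (Suc (k i)))) u) \<le> ?b" for i
      by (intro AE_I2) simp
    show "integrable ?\<sigma> (\<lambda>u. ?b)"
      by (intro sphere_measure_integrable[OF sphere_measure_spherical_lebesgue] continuous_on_const)
  qed
  then have "(\<integral>u. G \<rho> u \<partial>?\<sigma>) \<le> 0" using rhs le by (intro LIMSEQ_le) auto
  then have G_eq: "G \<rho> u0 = 0"
    using spherical_integral_continuous_pos[OF Gcont[OF \<rho>(1) ne(3)] G0 u0] G0[OF u0] by force
  then have "\<rho> u0 / ?\<rho>0 u0 = 1 \<or> ?\<rho>0 u0 powr q = \<rho> u0 powr q" 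
    using sw(2)[OF u0] by (auto simp: G_def)
  then show ?thesis
  proof
    assume "?\<rho>0 u0 powr q = \<rho> u0 powr q"
    then have "(?\<rho>0 u0 powr q) powr (1 / q) = (\<rho> u0 powr q) powr (1 / q)" by simp
    then show ?thesis using pos0(1)[OF u0] \<rho>r[OF u0] r q by (simp add: powr_powr)
  qed (use pos0(1)[OF u0] in simp)
qed

text \<open>
  If the distances stayed away from zero along a subsequence, then the pairs of support and radial
  functions would converge uniformly along a further one, by the Arzela-Ascoli theorem. By
  \<open>limit_radial_eq\<close> the limit of the radial functions is that of \<open>K 0\<close>, which makes the distances
  small.
\<close>

lemma weak_convergence_imp_hausdorff_convergence: "(\<lambda>i. hausdorff_distance (K (Suc i)) (K 0)) \<longlonglongrightarrow> 0"
proof (rule ccontr)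
  assume "\<not> ?thesis"
  then obtain \<epsilon> where \<epsilon>: "0 < \<epsilon>" "\<And>n. \<exists>i\<ge>n. \<epsilon> \<le> \<bar>hausdorff_distance (K (Suc i)) (K 0)\<bar>"
    unfolding LIMSEQ_iff by (auto simp: not_less)
  obtain r R n where P: "\<And>i. n \<le> i \<Longrightarrow> radial_support_pair r R (radial (K (Suc i))) (support_fun (K (Suc i)))"
    using eventually_uniform_radial_support_pair by blast
  have "\<forall>m. \<exists>i. max m n \<le> i \<and> \<epsilon> \<le> \<bar>hausdorff_distance (K (Suc i)) (K 0)\<bar>" using \<epsilon>(2) by blast
  then obtain k where k: "\<And>m. max m n \<le> k m"
    "\<And>m. \<epsilon> \<le> \<bar>hausdorff_distance (K (Suc (k m))) (K 0)\<bar>" by metis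
  have Pk: "radial_support_pair r R (radial (K (Suc (k m)))) (support_fun (K (Suc (k m))))" for m
    using P k(1)[of m] by simp
  note D = radial_support_pairD[OF Pk] and pos = radial_support_pair_pos[OF Pk]
  \<comment> \<open>one application of Arzela-Ascoli to the pair makes both functions converge along the same subsequence\<close>
  define F where "F m u = (support_fun (K (Suc (k m))) u, radial (K (Suc (k m))) u)" for m u
  obtain u1 :: 'a where u1: "norm u1 = 1" using norm_Basis SOME_Basis by blast
  have R: "0 < R" using pos(1)[OF u1, of 0] D(3)[OF u1, of 0] by linarith
  have bound: "norm (F m u) \<le> R + R" if "u \<in> sphere 0 1" for m u
  proof -
    have "norm (F m u) \<le> norm (support_fun (K (Suc (k m))) u) + norm (radial (K (Suc (k m))) u)"
      unfolding F_def by (rule norm_Pair_le)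
    also have "\<dots> \<le> R + R" using that pos[of u m] D(3)[of u m] D(5)[of u m] by (intro add_mono) auto
    finally show ?thesis .
  qed
  define L where "L = R + R\<^sup>2 / r"
  have L: "0 < L" using R D(1) by (auto simp: L_def intro!: add_pos_nonneg divide_nonneg_nonneg less_imp_le)
  have lip: "norm (F m u - F m v) \<le> L * norm (u - v)" if "norm u = 1" "norm v = 1" for m u v
  proof -
    have "norm (F m u - F m v) \<le> norm (support_fun (K (Suc (k m))) u - support_fun (K (Suc (k m))) v)
        + norm (radial (K (Suc (k m))) u - radial (K (Suc (k m))) v)"
      unfolding F_def diff_Pair by (rule norm_Pair_le)
    also have "\<dots> \<le> R * norm (u - v) + R\<^sup>2 / r * norm (u - v)"
      using radial_support_pair_support_lipschitz[OF Pk that, of m]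
        radial_support_pair_radial_lipschitz[OF Pk that, of m] by simp
    finally show ?thesis by (simp add: L_def algebra_simps)
  qed
  obtain g s where g: "continuous_on (sphere 0 1) g" "strict_mono (s :: nat \<Rightarrow> nat)"
    "\<And>e. 0 < e \<Longrightarrow> \<exists>N. \<forall>m u. m \<ge> N \<and> u \<in> sphere 0 1 \<longrightarrow> norm (F (s m) u - g u) < e"
  proof (rule Arzela_Ascoli[of "sphere 0 1" F "R + R"])
    fix u :: 'a and e :: real assume u: "u \<in> sphere 0 1" and e: "0 < e"
    show "\<exists>d>0. \<forall>m v. v \<in> sphere 0 1 \<and> norm (u - v) < d \<longrightarrow> norm (F m u - F m v) < e"
    proof (intro exI[of _ "e / L"] conjI allI impI)
      fix m and v :: 'a assume v: "v \<in> sphere 0 1 \<and> norm (u - v) < e / L"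
      then have "norm (F m u - F m v) \<le> L * norm (u - v)" using lip u by simp
      also have "\<dots> < e" using v L by (simp add: field_simps)
      finally show "norm (F m u - F m v) < e" .
    qed (use e L in simp)
  qed (use bound in auto)
  have proj: "norm (fst X) \<le> norm X" "norm (snd X) \<le> norm X" for X :: "real \<times> real"
    using norm_fst_le[of "fst X" "snd X"] norm_snd_le[of "snd X" "fst X"] by simp_all
  have comp: "\<bar>support_fun (K (Suc (k (s m)))) u - fst (g u)\<bar> \<le> norm (F (s m) u - g u)"
    "\<bar>radial (K (Suc (k (s m)))) u - snd (g u)\<bar> \<le> norm (F (s m) u - g u)" for m u
    using proj[of "F (s m) u - g u"] by (simp_all add: F_def)
  have "filterlim k at_top sequentially"
    using k(1) by (intro filterlim_at_top_mono[OF filterlim_ident]) (auto intro: max.boundedE)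
  then have lim: "filterlim (\<lambda>m. k (s m)) at_top sequentially"
    by (rule filterlim_compose) (rule filterlim_subseq[OF g(2)])
  have eq: "snd (g u) = radial (K 0) u" if "norm u = 1" for u
  proof (rule limit_radial_eq[OF lim Pk _ _ _ _ that])
    show "continuous_on (sphere 0 1) (\<lambda>u. fst (g u))" "continuous_on (sphere 0 1) (\<lambda>u. snd (g u))"
      by (intro continuous_intros g(1))+
    show "uniform_limit (sphere 0 1) (\<lambda>m. support_fun (K (Suc (k (s m))))) (\<lambda>u. fst (g u)) sequentially"
    proof (rule uniform_limitI)
      fix e :: real assume "0 < e"
      then obtain N where N: "\<forall>m u. m \<ge> N \<and> u \<in> sphere 0 1 \<longrightarrow> norm (F (s m) u - g u) < e" using g(3) by blast
      show "\<forall>\<^sub>F m in sequentially. \<forall>u\<in>sphere 0 1. dist (support_fun (K (Suc (k (s m)))) u) (fst (g u)) < e"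
        unfolding eventually_sequentially dist_real_def using N comp(1) by (meson le_less_trans)
    qed
    show "(\<lambda>m. radial (K (Suc (k (s m)))) u) \<longlonglongrightarrow> snd (g u)" if "norm u = 1" for u
    proof (rule LIMSEQ_I)
      fix e :: real assume "0 < e"
      then obtain N where N: "\<forall>m u. m \<ge> N \<and> u \<in> sphere 0 1 \<longrightarrow> norm (F (s m) u - g u) < e" using g(3) by blast
      show "\<exists>N. \<forall>m\<ge>N. norm (radial (K (Suc (k (s m)))) u - snd (g u)) < e"
      proof (intro exI[of _ N] allI impI)
        fix m assume "N \<le> m"
        then have "norm (F (s m) u - g u) < e" using N that by simp
        then show "norm (radial (K (Suc (k (s m)))) u - snd (g u)) < e" using comp(2)[of m u] by simp
      qed
    qed
  qed
  obtain N where N: "\<forall>m u. m \<ge> N \<and> u \<in> sphere 0 1 \<longrightarrow> norm (F (s m) u - g u) < \<epsilon> / 2"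
    using g(3)[of "\<epsilon> / 2"] \<epsilon>(1) by auto
  let ?K = "K (Suc (k (s N)))"
  obtain r0 R0 where P0: "radial_support_pair r0 R0 (radial (K 0)) (support_fun (K 0))"
    using convex_body_radial_support_pair[OF K] by blast
  have "\<bar>radial ?K u - radial (K 0) u\<bar> \<le> \<epsilon> / 2" if "norm u = 1" for u
    using comp(2)[of N u] N[rule_format, of N u] eq[OF that] that by simp
  then have hb: "\<bar>support_fun ?K u - support_fun (K 0) u\<bar> \<le> \<epsilon> / 2" if "norm u = 1" for u
    using support_diff_le_radial_diff[OF Pk P0 _ that] by blast
  have "hausdorff_distance ?K (K 0) \<le> \<epsilon> / 2"
    unfolding hausdorff_distance_def using hb u1 by (intro cSUP_least) (auto simp del: mult_2)
  moreover have "0 \<le> hausdorff_distance ?K (K 0)"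
    unfolding hausdorff_distance_def using hb u1
    by (intro order_trans[OF abs_ge_zero cSUP_upper[of u1]] bdd_aboveI2[of _ _ "\<epsilon> / 2"]) auto
  ultimately show False using k(2)[of "s N"] \<epsilon>(1) by linarith
qed

end

theorem theorem1p2:
  fixes p q :: real
    and Q :: "(real ^ 'n) set"
    and K :: "nat \<Rightarrow> (real ^ 'n) set"
  assumes "q < 0" and "0 \<le> p"
    and "Q \<in> star_bodies_o"
    and "\<And>i. K i \<in> convex_bodies_o"
    and "weakly_converges_sphere (\<lambda>i. Lp_dual_curvature p q (K (Suc i)) Q)
           (Lp_dual_curvature p q (K 0) Q)"
  shows "(\<lambda>i. hausdorff_distance (K (Suc i)) (K 0)) \<longlonglongrightarrow> 0"
  using assms by (rule weak_convergence_imp_hausdorff_convergence)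

end
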